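(* Let $\mu=\mu_1\otimes\cdots\otimes\mu_n$ be any product probability measure on $\Omega^n$, where $\Omega$ is a Polish space. Let $f:\Omega^n\to\mathcal{H}_d$ be such that $$v_f:=\sup_{(x_1,\dots,x_n)\in\Omega^n}\Big\|\sum_{i=1}^n\int\big(f(x_1,\dots,x_n)-f(x_1,\dots,x_{i-1},z,x_{i+1},\dots,x_n)\big)^2d\mu_i(z)\Big\|$$ is finite. Then, for any $t\ge0$, $$\mu\Big(\lambda_{\max}\big(f-\mathbb{E}_\mu f\big)\ge t\Big)\le d\,\exp\Big(-\frac{t^2}{v_f+t\sqrt{v_f}}\Big).$$
   Context: $\mathcal{H}_d$ is the set of $d\times d$ Hermitian matrices, $\|\cdot\|$ is the operator norm, $\lambda_{\max}$ is the largest eigenvalue; functions are measurable; integrals and expectations of matrix-valued functions are entrywise, and squares are matrix squares. *)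

theory Defs
  imports "HOL-Probability.Probability"
begin

definition hermitian :: "complex^'d^'d \<Rightarrow> bool" where
  "hermitian A \<longleftrightarrow> (\<forall>a b. A $ a $ b = cnj (A $ b $ a))"

text \<open>Operator norm induced by the Euclidean norm of \<open>complex^'d\<close>.\<close>

definition op_norm :: "complex^'d^'d \<Rightarrow> real" where
  "op_norm A = onorm (\<lambda>u. A *v u)"

definition is_eigenvalue :: "complex^'d^'d \<Rightarrow> complex \<Rightarrow> bool" where
  "is_eigenvalue A c \<longleftrightarrow> (\<exists>u. u \<noteq> 0 \<and> A *v u = c *s u)"

text \<open>Only meaningful for Hermitian \<open>A\<close>, all of whose eigenvalues are real.\<close>

definition lambda_max :: "complex^'d^'d \<Rightarrow> real" where
  "lambda_max A = Max {r. is_eigenvalue A (complex_of_real r)}"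

definition mat_integrable :: "'b measure \<Rightarrow> ('b \<Rightarrow> complex^'d^'d) \<Rightarrow> bool" where
  "mat_integrable M g \<longleftrightarrow> (\<forall>a b. integrable M (\<lambda>z. g z $ a $ b))"

definition mat_integral :: "'b measure \<Rightarrow> ('b \<Rightarrow> complex^'d^'d) \<Rightarrow> complex^'d^'d" where
  "mat_integral M g = (\<chi> a b. \<integral>z. g z $ a $ b \<partial>M)"

definition mat_square :: "complex^'d^'d \<Rightarrow> complex^'d^'d" where
  "mat_square A = A ** A"

text \<open>
  The quantity \<open>v\<^sub>f\<close>, with values in \<open>[0, \<infinity>]\<close>.  A point of \<open>\<Omega>\<^sup>n\<close> is an extensional function
  on \<open>{1..n}\<close>, and \<open>x(i := z)\<close> replaces its \<open>i\<close>-th coordinate.  The integrands are positive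
  semidefinite, so a non-integrable entry means that some diagonal integral is infinite; as the
  Bochner integral would be \<open>0\<close> there, the value \<open>\<infinity>\<close> is assigned explicitly.
\<close>

definition v_fun ::
  "nat \<Rightarrow> (nat \<Rightarrow> 'a measure) \<Rightarrow> ((nat \<Rightarrow> 'a) \<Rightarrow> complex^'d^'d) \<Rightarrow> ennreal" where
  "v_fun n \<mu> f =
    (SUP x \<in> space (PiM {1..n} \<mu>).
      if \<forall>i\<in>{1..n}. mat_integrable (\<mu> i) (\<lambda>z. mat_square (f x - f (x(i := z))))
      then ennreal (op_norm (\<Sum>i=1..n. mat_integral (\<mu> i) (\<lambda>z. mat_square (f x - f (x(i := z))))))
      else \<infinity>)"

end

(*
  If v is finite, then changing one coordinate changes f by a bounded amount, so f is bounded.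
  Up to tau = t / sqrt v = 5/4 the claim follows from Cantelli's inequality and the Efron-Stein
  bound E |f - E f|^2 <= d v / 2 in Frobenius norm.

  For larger tau, symmetrize: G(x,y) = f x - f y on the product of the probability space with
  itself, and H = sinh(k G) with k = 1 / (2 sqrt v).  By antisymmetry E H = 0, so Efron-Stein,
  applied in x and in y separately, bounds E |H|^2 by coordinatewise fluctuations of H.  Expanding
  in two eigenbases reduces the trace inequality
    |sinh X - sinh Y|^2 <= (|(X - Y) cosh X|^2 + |(X - Y) cosh Y|^2) / 2
  to its scalar version, and exchangeability of a coordinate and its replacement turns this into
  E |H|^2 <= (d + E |H|^2) / 4.  Hence E tr exp(2 k G) = d + 2 E |H|^2 <= 5 d / 3; Jensen's inequality
  in y and Markov's inequality give the bound (5/3) d exp(-tau), which suffices for tau >= 5/4.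
*)

theory Submission
  imports Defs
begin

section \<open>Hermitian matrices and the spectral theorem\<close>

text \<open>The hypothesis controls only the operator norm of a sum of integrated squares D_i^2. It
  becomes usable when multiplied by a matrix C that does not depend on the resampled coordinate:
  summing the quadratic form over the columns of C gives sum_i E |D_i C|^2 <= v |C|^2 in Frobenius
  norm. The terms in which C sees the resampled point instead are the reason for the exchangeability
  argument. Symmetrization removes the mean: for f - E f the term |E sinh|^2 would remain in the
  variance, and the estimate of E |H|^2 by itself would not close. The choice 2 k sqrt v = 1 gives
  decay exp(-tau), better than the required exp(-tau^2 / (1 + tau)) by the factor exp(tau / (1 +
  tau)). This gain must pay for the prefactor 5/3, which it cannot do for small tau; hence the
  separate second-moment argument there. The exponential bound suffices from about 1.05 on and the
  second-moment one up to (1 + sqrt 3) / 2, so 5/4 is a convenient value in between.\<close>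

definition adj :: "complex^'m^'n \<Rightarrow> complex^'n^'m" where
  "adj A = (\<chi> i j. cnj (A $ j $ i))"

definition cip :: "complex^'n \<Rightarrow> complex^'n \<Rightarrow> complex" where
  "cip u w = (\<Sum>a\<in>UNIV. cnj (u $ a) * w $ a)"

definition rdiag :: "('n \<Rightarrow> real) \<Rightarrow> complex^'n^'n" where
  "rdiag a = (\<chi> i j. if i = j then complex_of_real (a i) else 0)"

lemma adj_nth [simp]: "adj A $ i $ j = cnj (A $ j $ i)"
  by (simp add: adj_def)

lemma adj_adj [simp]: "adj (adj A) = A"
  by (simp add: vec_eq_iff)

lemma adj_mult: "adj (A ** B) = adj B ** adj A"
  by (simp add: vec_eq_iff matrix_matrix_mult_def mult.commute)

lemma hermitian_iff_adj: "hermitian A \<longleftrightarrow> adj A = A"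
  unfolding hermitian_def vec_eq_iff adj_nth by metis

lemma cip_adj: "cip (A *v u) w = cip u (adj A *v w)"
proof -
  have "cip (A *v u) w = (\<Sum>i\<in>UNIV. \<Sum>j\<in>UNIV. cnj (A$i$j) * cnj (u$j) * w$i)"
    by (simp add: cip_def matrix_vector_mult_def sum_distrib_right)
  also have "\<dots> = (\<Sum>j\<in>UNIV. \<Sum>i\<in>UNIV. cnj (A$i$j) * cnj (u$j) * w$i)"
    by (rule sum.swap)
  also have "\<dots> = cip u (adj A *v w)"
    by (simp add: cip_def matrix_vector_mult_def sum_distrib_left algebra_simps)
  finally show ?thesis .
qed

lemma cip_hermitian: "hermitian A \<Longrightarrow> cip (A *v u) w = cip u (A *v w)"
  by (simp add: cip_adj hermitian_iff_adj)

lemma norm_vec_sq: "(norm (x :: 'a::real_normed_vector^'n))\<^sup>2 = (\<Sum>i\<in>UNIV. (norm (x $ i))\<^sup>2)"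
  by (simp add: norm_vec_def L2_set_def sum_nonneg)

text \<open>On the nested vector type \<open>norm\<close> is the Frobenius norm. It comes from an
  inner product and is unitarily invariant on both sides, so traces of squares can be handled as
  norms; \<open>op_norm\<close> enters only through \<open>op_norm_bound\<close>.\<close>

lemma norm_mat_sq: "(norm (A :: complex^'m^'n))\<^sup>2 = (\<Sum>i\<in>UNIV. \<Sum>j\<in>UNIV. (cmod (A $ i $ j))\<^sup>2)"
  by (simp add: norm_vec_sq)

lemma cip_self: "cip u u = complex_of_real ((norm u)\<^sup>2)"
  by (simp only: cip_def norm_vec_sq of_real_sum complex_norm_square mult.commute)

lemma cip_add_left: "cip (u + v) w = cip u w + cip v w"
  by (simp add: cip_def sum.distrib algebra_simps)

lemma cip_add_right: "cip u (v + w) = cip u v + cip u w"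
  by (simp add: cip_def sum.distrib algebra_simps)

lemma cip_diff_right: "cip u (v - w) = cip u v - cip u w"
  by (simp add: cip_def sum_subtractf algebra_simps)

lemma cip_smult_right: "cip u (c *s v) = c * cip u v"
  by (simp add: cip_def sum_distrib_left algebra_simps)

lemma cip_smult_left: "cip (c *s u) v = cnj c * cip u v"
  by (simp add: cip_def sum_distrib_left algebra_simps)

lemma cip_commute: "cip v u = cnj (cip u v)"
  by (simp add: cip_def mult.commute)

lemma Re_cip_le: "Re (cip u w) \<le> norm u * norm w"
proof -
  have "Re (cip u w) = u \<bullet> w"
    by (simp add: cip_def inner_vec_def inner_complex_def)
  then show ?thesis using norm_cauchy_schwarz[of u w] by simp
qed

lemma norm_cvec_smult: "norm (c *s (u :: complex^'n)) = cmod c * norm u"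
proof -
  have "(norm (c *s u))\<^sup>2 = (cmod c * norm u)\<^sup>2"
    by (simp add: norm_vec_sq norm_mult power_mult_distrib sum_distrib_left)
  then show ?thesis by (simp add: power2_eq_iff_nonneg)
qed

lemma norm_mult_sq_columns:
  "(norm (D ** C))\<^sup>2 = (\<Sum>b\<in>UNIV. (norm (D *v column b (C :: complex^'m^'k)))\<^sup>2)"
proof -
  have "(norm (D ** C))\<^sup>2 = (\<Sum>i\<in>UNIV. \<Sum>b\<in>UNIV. (cmod ((D *v column b C) $ i))\<^sup>2)"
    by (simp add: norm_mat_sq matrix_matrix_mult_def matrix_vector_mult_def column_def)
  also have "\<dots> = (\<Sum>b\<in>UNIV. \<Sum>i\<in>UNIV. (cmod ((D *v column b C) $ i))\<^sup>2)"
    by (rule sum.swap)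
  finally show ?thesis by (simp add: norm_vec_sq)
qed

lemma norm_sq_columns: "(norm (C :: complex^'m^'k))\<^sup>2 = (\<Sum>b\<in>UNIV. (norm (column b C))\<^sup>2)"
  using norm_mult_sq_columns[of "mat 1" C] by simp

lemma norm_adj [simp]: "norm (adj A) = norm A"
proof -
  have "(norm (adj A))\<^sup>2 = (norm A)\<^sup>2"
    unfolding norm_mat_sq by (subst sum.swap) simp
  then show ?thesis by (simp add: power2_eq_iff_nonneg)
qed

lemma norm_isometry_vec:
  assumes "adj U ** U = mat 1" shows "norm (U *v w) = norm w"
proof -
  have "cip (U *v w) (U *v w) = cip w w"
    by (simp add: cip_adj matrix_vector_mul_assoc assms)
  then have "(norm (U *v w))\<^sup>2 = (norm w)\<^sup>2"
    by (simp only: cip_self of_real_eq_iff)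
  then show ?thesis by (simp add: power2_eq_iff_nonneg)
qed

lemma norm_isometry_left:
  assumes "adj U ** U = mat 1" shows "norm (U ** A) = norm A"
proof -
  have "(norm (U ** A))\<^sup>2 = (norm A)\<^sup>2"
    by (simp add: norm_mult_sq_columns norm_isometry_vec[OF assms] norm_sq_columns[of A])
  then show ?thesis by (simp add: power2_eq_iff_nonneg)
qed

lemma norm_isometry_right:
  assumes "U ** adj U = mat 1" shows "norm (A ** U) = norm A"
  using norm_isometry_left[of "adj U" "adj A"] assms
  by (simp flip: adj_mult)

lemma norm_matrix_vector_le: "norm (A *v w) \<le> norm A * norm (w :: complex^'n)"
proof -
  have "cmod ((A *v w) $ i) \<le> norm (A $ i) * norm w" for i
  proof -
    have "cmod ((A *v w) $ i) \<le> (\<Sum>j\<in>UNIV. \<bar>cmod (A$i$j)\<bar> * \<bar>cmod (w$j)\<bar>)"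
      by (simp add: matrix_vector_mult_def norm_mult sum_norm_le)
    also have "\<dots> \<le> norm (A $ i) * norm w"
      unfolding norm_vec_def by (rule L2_set_mult_ineq)
    finally show ?thesis .
  qed
  then have "(norm (A *v w))\<^sup>2 \<le> (\<Sum>i\<in>UNIV. (norm (A $ i) * norm w)\<^sup>2)"
    unfolding norm_vec_sq[of "A *v w"] by (intro sum_mono power_mono) auto
  also have "\<dots> = (norm A * norm w)\<^sup>2"
    by (simp add: power_mult_distrib norm_vec_sq[of A] flip: sum_distrib_right)
  finally show ?thesis by (rule power2_le_imp_le) simp
qed

lemma op_norm_bound: "norm (A *v w) \<le> op_norm A * norm w"
  unfolding op_norm_def
  by (rule onorm) (rule linear_conv_bounded_linear[THEN iffD1], simp)

section \<open>Spectral theorem\<close>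

lemma exists_orthogonal_eigenvector:
  fixes A :: "complex^'n^'n" and u :: "'n \<Rightarrow> complex^'n"
  assumes A: "hermitian A" and i: "i \<notin> S"
    and eig: "\<And>j. j \<in> S \<Longrightarrow> A *v u j = complex_of_real (a j) *s u j"
  shows "\<exists>w c. norm w = 1 \<and> (\<forall>j\<in>S. cip (u j) w = 0) \<and> A *v w = complex_of_real c *s w"
proof -
  \<comment> \<open>The kernel of \<open>B\<close> is the orthogonal complement of the vectors found
    so far. Row \<open>i\<close> vanishes because \<open>i\<close> is outside \<open>S\<close>, so
    \<open>B\<close> is singular and the complement is not trivial.\<close>
  define B :: "complex^'n^'n" where "B = (\<chi> j. if j \<in> S then (\<chi> k. cnj (u j $ k)) else 0)"
  have Bnth: "(B *v w) $ j = (if j \<in> S then cip (u j) w else 0)" for j w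
    by (simp add: B_def matrix_vector_mult_def cip_def)
  have "\<not> (\<exists>C. C ** B = mat 1)"
  proof
    assume "\<exists>C. C ** B = mat 1"
    then obtain C where "B ** C = mat 1" by (auto simp: matrix_left_right_inverse)
    then have "(B ** C) $ i $ i = 1" by (simp add: mat_def)
    then show False using i by (simp add: matrix_matrix_mult_def B_def)
  qed
  then obtain w0 where w0: "B *v w0 = 0" "w0 \<noteq> 0"
    by (auto simp: matrix_left_invertible_ker)
  \<comment> \<open>The new eigenvector maximizes the quadratic form of \<open>A\<close> over the
    unit sphere of this complement, which is compact.\<close>
  define K where "K = {w. norm w = 1 \<and> B *v w = 0}"
  have contB: "continuous_on UNIV (\<lambda>w. M *v w)" for M :: "complex^'n^'n"
    by (intro linear_continuous_on linear_conv_bounded_linear[THEN iffD1]) simp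
  have "closed K"
    unfolding K_def by (intro closed_Collect_conj closed_Collect_eq continuous_intros contB)
  moreover have "bounded K"
    by (rule boundedI[of _ 1]) (auto simp: K_def)
  ultimately have "compact K" by (simp add: compact_eq_bounded_closed)
  moreover have "(complex_of_real (inverse (norm w0))) *s w0 \<in> K"
    using w0 by (simp add: K_def norm_cvec_smult norm_inverse vector_scalar_commute)
  then have "K \<noteq> {}" by blast
  moreover have "continuous_on K (\<lambda>w. Re (cip w (A *v w)))"
    unfolding cip_def
    by (intro continuous_intros continuous_on_subset[OF contB]) auto
  ultimately obtain w where w: "w \<in> K" and
    max: "\<And>y. y \<in> K \<Longrightarrow> Re (cip y (A *v y)) \<le> Re (cip w (A *v w))"
    using continuous_attains_sup[of K "\<lambda>w. Re (cip w (A *v w))"] by blast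
  define c where "c = Re (cip w (A *v w))"
  have wn: "norm w = 1" and Bw: "B *v w = 0" using w by (auto simp: K_def)
  define r where "r = A *v w - complex_of_real c *s w"
  have Bker: "B *v y = 0 \<longleftrightarrow> (\<forall>j\<in>S. cip (u j) y = 0)" for y
    using Bnth[of y] by (auto simp: vec_eq_iff)
  have "cip (u j) (A *v w) = 0" if "j \<in> S" for j
    using cip_hermitian[OF A, of "u j" w] eig[OF that] Bw that Bker by (simp add: cip_smult_left)
  then have Br: "B *v r = 0"
    using Bw by (simp add: Bker r_def cip_diff_right cip_smult_right)
  have bound: "Re (cip y (A *v y)) \<le> c * (norm y)\<^sup>2" if "B *v y = 0" for y
  proof (cases "y = 0")
    case True then show ?thesis by (simp add: cip_def)
  next
    case False
    define k where "k = complex_of_real (inverse (norm y))"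
    have "k *s y \<in> K"
      using False that by (simp add: K_def k_def norm_cvec_smult norm_inverse vector_scalar_commute)
    from max[OF this] have "Re (cip (k *s y) (A *v (k *s y))) \<le> c" by (simp add: c_def)
    moreover have "cip (k *s y) (A *v (k *s y)) = complex_of_real (inverse (norm y) ^ 2) * cip y (A *v y)"
      by (simp add: vector_scalar_commute cip_smult_left cip_smult_right k_def power2_eq_square)
    ultimately have "inverse (norm y) ^ 2 * Re (cip y (A *v y)) \<le> c"
      by (simp only: times_complex.sel Re_complex_of_real Im_complex_of_real mult_zero_left diff_zero)
    then show ?thesis using False by (simp add: power_inverse field_simps)
  qed
  have "r = 0"
  proof (rule ccontr)
    assume "r \<noteq> 0"
    define k where "k = c * (norm r)\<^sup>2 - Re (cip r (A *v r))"
    \<comment> \<open>First variation at the maximum: \<open>r\<close> lies in the complement, so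
      \<open>w + s r\<close> is admissible for every real \<open>s\<close>. The linear term of the
      comparison is \<open>2 * s * (norm r)\<^sup>2\<close>, and for small positive \<open>s\<close>
      a quadratic term cannot dominate it unless \<open>r = 0\<close>.\<close>
    have ineq: "2 * s * (norm r)\<^sup>2 \<le> s\<^sup>2 * k" for s :: real
    proof -
      define y where "y = w + complex_of_real s *s r"
      have "B *v y = 0" using Bw Br by (simp add: y_def matrix_vector_right_distrib vector_scalar_commute)
      from bound[OF this] have b: "Re (cip y (A *v y)) \<le> c * (norm y)\<^sup>2" .
      have sym: "Re (cip w (A *v r)) = Re (cip r (A *v w))"
        unfolding cip_hermitian[OF A, of w r, symmetric] cip_commute[of "A *v w" r] by simp
      have Aw: "A *v w = r + complex_of_real c *s w" by (simp add: r_def)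
      have "Re (cip y (A *v y)) = c + 2 * s * Re (cip r (A *v w)) + s\<^sup>2 * Re (cip r (A *v r))"
        by (simp add: y_def matrix_vector_right_distrib vector_scalar_commute cip_add_left cip_add_right
            cip_smult_left cip_smult_right sym c_def power2_eq_square algebra_simps)
      moreover have "Re (cip r (A *v w)) = (norm r)\<^sup>2 + c * Re (cip r w)"
        by (simp add: Aw cip_add_right cip_smult_right cip_self del: of_real_power)
      moreover have "Re (cip y y) = 1 + 2 * s * Re (cip r w) + s\<^sup>2 * (norm r)\<^sup>2"
        using wn arg_cong[OF cip_commute[of w r], of Re]
        by (simp add: y_def cip_add_left cip_add_right cip_smult_left cip_smult_right
            cip_self[of w] cip_self[of r] power2_eq_square algebra_simps)
      moreover have "(norm y)\<^sup>2 = Re (cip y y)" by (simp add: cip_self del: of_real_power)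
      ultimately show ?thesis using b unfolding k_def by (simp add: algebra_simps)
    qed
    have pos: "(norm r)\<^sup>2 > 0" using \<open>r \<noteq> 0\<close> by simp
    show False
    proof (cases "k \<le> 0")
      case True
      with ineq[of 1] pos show False by simp
    next
      case False
      \<comment> \<open>The value of \<open>s\<close> at which the quadratic violates
        \<open>ineq\<close> most.\<close>
      define q where "q = (norm r)\<^sup>2 / k"
      have r: "(norm r)\<^sup>2 = q * k" using False by (simp add: q_def)
      have "0 < q * (q * k)" using pos False by (simp add: q_def)
      moreover have "2 * (q * (q * k)) \<le> q * (q * k)"
        using ineq[of q] unfolding r by (simp add: power2_eq_square)
      ultimately show False by linarith
    qed
  qed
  then show ?thesis using wn Bw Bker unfolding r_def by (intro exI[of _ w] exI[of _ c]) auto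
qed

definition spectral :: "complex^'n^'n \<Rightarrow> complex^'n^'n \<Rightarrow> ('n \<Rightarrow> real) \<Rightarrow> bool" where
  "spectral A U a \<longleftrightarrow> adj U ** U = mat 1 \<and> U ** adj U = mat 1 \<and> A = U ** rdiag a ** adj U"

text \<open>Orthonormal eigenvectors are indexed by the coordinate type itself and collected by
  induction on the finite set of indices already served. At \<open>UNIV\<close> they are the columns
  of a square isometry, which is automatically unitary.\<close>

theorem hermitian_spectral:
  fixes A :: "complex^'n^'n"
  assumes A: "hermitian A"
  shows "\<exists>U a. spectral A U a"
proof -
  have "\<exists>u a. (\<forall>i\<in>S. \<forall>j\<in>S. cip (u i) (u j) = (if i = j then 1 else 0)) \<and>
      (\<forall>j\<in>S. A *v u j = complex_of_real (a j) *s u j)" if "finite S" for S :: "'n set"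
    using that
  proof (induction S rule: finite_induct)
    case empty
    then show ?case by simp
  next
    case (insert i S)
    then obtain u :: "'n \<Rightarrow> complex^'n" and a where
      u: "\<And>i j. i \<in> S \<Longrightarrow> j \<in> S \<Longrightarrow> cip (u i) (u j) = (if i = j then 1 else 0)"
      and a: "\<And>j. j \<in> S \<Longrightarrow> A *v u j = complex_of_real (a j) *s u j"
      by blast
    obtain w c where w: "norm w = 1" "\<And>j. j \<in> S \<Longrightarrow> cip (u j) w = 0"
      "A *v w = complex_of_real c *s w"
      using exists_orthogonal_eigenvector[OF A insert.hyps(2), of u a] a by blast
    have "cip w (u j) = 0" if "j \<in> S" for j
      using w(2)[OF that] cip_commute[of w "u j"] by simp
    then show ?case
      using u a w insert.hyps(2)
      by (intro exI[of _ "u(i := w)"] exI[of _ "a(i := c)"]) (auto simp: cip_self[of w])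
  qed
  from this[of UNIV] obtain u :: "'n \<Rightarrow> complex^'n" and a where
    u: "\<And>i j. cip (u i) (u j) = (if i = j then 1 else 0)"
    and a: "\<And>j. A *v u j = complex_of_real (a j) *s u j"
    by auto
  define U :: "complex^'n^'n" where "U = (\<chi> i j. u j $ i)"
  have U1: "adj U ** U = mat 1"
    using u by (auto simp: vec_eq_iff matrix_matrix_mult_def U_def cip_def mat_def)
  then have U2: "U ** adj U = mat 1" by (simp add: matrix_left_right_inverse)
  have "A ** U = U ** rdiag a"
  proof -
    have "(A ** U) $ i $ j = (A *v u j) $ i" for i j
      by (simp add: matrix_matrix_mult_def matrix_vector_mult_def U_def)
    moreover have "(U ** rdiag a) $ i $ j = complex_of_real (a j) * u j $ i" for i j
      by (simp add: matrix_matrix_mult_def rdiag_def U_def if_distrib cong: if_cong)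
    ultimately show ?thesis by (simp add: vec_eq_iff a)
  qed
  then have "A = U ** rdiag a ** adj U"
    by (metis U2 matrix_mul_assoc matrix_mul_rid)
  with U1 U2 show ?thesis by (auto simp: spectral_def)
qed

lemma matrix_diff_left: "(A - B) ** C = A ** C - B ** (C :: complex^'p^'n)"
  by (simp add: vec_eq_iff matrix_matrix_mult_def sum_subtractf algebra_simps)

lemma matrix_diff_right: "C ** (A - B) = C ** A - C ** (B :: complex^'p^'n)"
  by (simp add: vec_eq_iff matrix_matrix_mult_def sum_subtractf algebra_simps)

lemma rdiag_mult_nth: "(rdiag a ** W) $ i $ j = complex_of_real (a i) * W $ i $ j"
  by (simp add: matrix_matrix_mult_def rdiag_def if_distrib if_distribR cong: if_cong)

lemma mult_rdiag_nth: "(W ** rdiag b) $ i $ j = W $ i $ j * complex_of_real (b j)"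
  by (simp add: matrix_matrix_mult_def rdiag_def if_distrib cong: if_cong)

lemma rdiag_vector_nth: "(rdiag a *v w) $ i = complex_of_real (a i) * w $ i"
  by (simp add: matrix_vector_mult_def rdiag_def if_distrib if_distribR cong: if_cong)

lemma norm_rdiag_sq: "(norm (rdiag a))\<^sup>2 = (\<Sum>i\<in>UNIV. (a i)\<^sup>2)"
proof -
  have "(\<Sum>j\<in>UNIV. (cmod (rdiag a $ i $ j))\<^sup>2) = (\<Sum>j\<in>UNIV. if i = j then (a i)\<^sup>2 else 0)" for i
    by (intro sum.cong) (auto simp: rdiag_def)
  then show ?thesis by (simp add: norm_mat_sq)
qed

section \<open>Functions of Hermitian matrices\<close>

text \<open>Squared modulus of the inner product of column \<open>i\<close> of \<open>U\<close> with
  column \<open>j\<close> of \<open>V\<close>. For two eigenbases these are doubly stochastic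
  weights, and every Frobenius norm comparing functions of two matrices becomes a sum with these
  same weights.\<close>

definition overlap :: "complex^'n^'n \<Rightarrow> complex^'n^'n \<Rightarrow> 'n \<Rightarrow> 'n \<Rightarrow> real" where
  "overlap U V i j = (cmod ((adj U ** V) $ i $ j))\<^sup>2"

lemma overlap_nonneg [simp]: "0 \<le> overlap U V i j"
  by (simp add: overlap_def)

lemma overlap_commute: "overlap V U j i = overlap U V i j"
proof -
  have "adj V ** U = adj (adj U ** V)" by (simp add: adj_mult)
  then show ?thesis by (simp add: overlap_def)
qed

text \<open>Using one eigenbasis on the left and the other on the right gives the difference the
  entries \<open>(a i - b j) * W $ i $ j\<close> with \<open>W = adj U ** V\<close>. Two matrices
  that need not commute are thus compared entry by entry.\<close>

lemma basis_change_diff: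
  assumes "adj U ** U = mat 1" "adj V ** V = mat 1"
  shows "adj U ** (U ** rdiag a ** adj U - V ** rdiag b ** adj V) ** V
    = rdiag a ** (adj U ** V) - (adj U ** V) ** rdiag b"
proof -
  have "adj U ** (U ** rdiag a ** adj U) ** V = (adj U ** U) ** rdiag a ** (adj U ** V)"
    by (simp add: matrix_mul_assoc)
  moreover have "adj U ** (V ** rdiag b ** adj V) ** V = (adj U ** V) ** rdiag b ** (adj V ** V)"
    by (simp add: matrix_mul_assoc)
  ultimately show ?thesis
    by (simp add: matrix_diff_left matrix_diff_right assms)
qed

lemma norm_basis_change:
  assumes "U ** adj U = mat 1" "V ** adj V = mat 1"
  shows "norm (adj U ** X ** V) = norm X"
  using norm_isometry_right[OF assms(2), of "adj U ** X"] norm_isometry_left[of "adj U" X] assms(1)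
  by simp

lemma norm_diff_spectral:
  assumes "spectral A U a" "spectral B V b"
  shows "(norm (U ** rdiag \<alpha> ** adj U - V ** rdiag \<beta> ** adj V))\<^sup>2
    = (\<Sum>i\<in>UNIV. \<Sum>j\<in>UNIV. (\<alpha> i - \<beta> j)\<^sup>2 * overlap U V i j)"
proof -
  let ?X = "U ** rdiag \<alpha> ** adj U - V ** rdiag \<beta> ** adj V"
  have U: "adj U ** U = mat 1" "U ** adj U = mat 1" and V: "adj V ** V = mat 1" "V ** adj V = mat 1"
    using assms by (auto simp: spectral_def)
  have "norm ?X = norm (rdiag \<alpha> ** (adj U ** V) - (adj U ** V) ** rdiag \<beta>)"
    using norm_basis_change[OF U(2) V(2), of ?X] basis_change_diff[OF U(1) V(1), of \<alpha> \<beta>] by simp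
  moreover have "(rdiag \<alpha> ** (adj U ** V) - (adj U ** V) ** rdiag \<beta>) $ i $ j
      = complex_of_real (\<alpha> i - \<beta> j) * (adj U ** V) $ i $ j" for i j
    by (simp add: rdiag_mult_nth mult_rdiag_nth algebra_simps)
  ultimately show ?thesis
    by (simp add: norm_mat_sq norm_mult power_mult_distrib overlap_def del: of_real_diff)
qed

lemma norm_diff_mult_spectral_right:
  assumes "spectral A U a" "spectral B V b"
  shows "(norm ((A - B) ** (V ** rdiag \<gamma> ** adj V)))\<^sup>2
    = (\<Sum>i\<in>UNIV. \<Sum>j\<in>UNIV. (a i - b j)\<^sup>2 * (\<gamma> j)\<^sup>2 * overlap U V i j)"
proof -
  have U: "adj U ** U = mat 1" "U ** adj U = mat 1" and V: "adj V ** V = mat 1" "V ** adj V = mat 1"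
    and A: "A = U ** rdiag a ** adj U" and B: "B = V ** rdiag b ** adj V"
    using assms by (auto simp: spectral_def)
  have "norm ((A - B) ** (V ** rdiag \<gamma> ** adj V)) = norm (adj U ** ((A - B) ** (V ** rdiag \<gamma> ** adj V)) ** V)"
    by (simp add: norm_basis_change U V)
  also have "adj U ** ((A - B) ** (V ** rdiag \<gamma> ** adj V)) ** V
      = (adj U ** (A - B) ** V) ** rdiag \<gamma> ** (adj V ** V)"
    by (simp add: matrix_mul_assoc)
  also have "\<dots> = (rdiag a ** (adj U ** V) - (adj U ** V) ** rdiag b) ** rdiag \<gamma>"
    using basis_change_diff[OF U(1) V(1), of a b] by (simp add: A B V)
  finally have "norm ((A - B) ** (V ** rdiag \<gamma> ** adj V))
      = norm ((rdiag a ** (adj U ** V) - (adj U ** V) ** rdiag b) ** rdiag \<gamma>)" .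
  moreover have "((rdiag a ** (adj U ** V) - (adj U ** V) ** rdiag b) ** rdiag \<gamma>) $ i $ j
      = complex_of_real ((a i - b j) * \<gamma> j) * (adj U ** V) $ i $ j" for i j
    by (simp add: rdiag_mult_nth mult_rdiag_nth algebra_simps)
  ultimately show ?thesis
    by (simp add: norm_mat_sq norm_mult power_mult_distrib overlap_def del: of_real_diff of_real_mult)
qed

text \<open>The function of \<open>A\<close> still stands to the right of \<open>A - B\<close>, the
  order in which \<open>fluctuation_le\<close> bounds a product. Exchanging the two matrices reduces
  this to \<open>norm_diff_mult_spectral_right\<close>, since the weights only get
  transposed.\<close>

lemma norm_diff_mult_spectral_left:
  assumes "spectral A U a" "spectral B V b"
  shows "(norm ((A - B) ** (U ** rdiag \<gamma> ** adj U)))\<^sup>2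
    = (\<Sum>i\<in>UNIV. \<Sum>j\<in>UNIV. (a i - b j)\<^sup>2 * (\<gamma> i)\<^sup>2 * overlap U V i j)"
proof -
  have "(A - B) ** (U ** rdiag \<gamma> ** adj U) = - ((B - A) ** (U ** rdiag \<gamma> ** adj U))"
    by (simp add: matrix_diff_left)
  then have "(norm ((A - B) ** (U ** rdiag \<gamma> ** adj U)))\<^sup>2
    = (\<Sum>j\<in>UNIV. \<Sum>i\<in>UNIV. (b j - a i)\<^sup>2 * (\<gamma> i)\<^sup>2 * overlap V U j i)"
    using norm_diff_mult_spectral_right[OF assms(2,1), of \<gamma>] by simp
  also have "\<dots> = (\<Sum>i\<in>UNIV. \<Sum>j\<in>UNIV. (a i - b j)\<^sup>2 * (\<gamma> i)\<^sup>2 * overlap U V i j)"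
    by (subst sum.swap) (simp add: overlap_commute[of V U] power2_commute)
  finally show ?thesis .
qed

definition mfun :: "(real \<Rightarrow> real) \<Rightarrow> complex^'n^'n \<Rightarrow> complex^'n^'n" where
  "mfun g A = (let (U, a) = (SOME (U, a). spectral A U a) in U ** rdiag (\<lambda>i. g (a i)) ** adj U)"

text \<open>The choice in \<open>mfun\<close> is harmless. Two decompositions of the same
  \<open>A\<close> have difference 0, and the weighted expansion of its norm shows that a weight can
  be nonzero only where the two eigenvalues agree. There the values of \<open>g\<close> agree too,
  so the same expansion with \<open>g\<close> inserted vanishes.\<close>

lemma mfun_eq:
  assumes "spectral A U a"
  shows "mfun g A = U ** rdiag (\<lambda>i. g (a i)) ** adj U"
proof -
  define p where "p = (SOME (V, b). spectral A V b)"
  have "case p of (V, b) \<Rightarrow> spectral A V b"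
    unfolding p_def by (rule someI[where x = "(U, a)"]) (simp add: assms)
  then obtain V b where p: "p = (V, b)" and V: "spectral A V b" by (cases p) auto
  have "(\<Sum>i\<in>UNIV. \<Sum>j\<in>UNIV. (b i - a j)\<^sup>2 * overlap V U i j) = 0"
    using norm_diff_spectral[OF V assms, of b a] V assms by (simp add: spectral_def)
  then have "(b i - a j)\<^sup>2 * overlap V U i j = 0" for i j
    by (simp add: sum_nonneg_eq_0_iff sum_nonneg)
  then have "(g (b i) - g (a j))\<^sup>2 * overlap V U i j = 0" for i j
    by (metis eq_iff_diff_eq_0 mult_eq_0_iff power2_eq_iff zero_eq_power2)
  then have "(norm (V ** rdiag (\<lambda>i. g (b i)) ** adj V - U ** rdiag (\<lambda>i. g (a i)) ** adj U))\<^sup>2 = 0"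
    by (simp only: norm_diff_spectral[OF V assms] sum.neutral_const)
  then show ?thesis using p by (simp add: mfun_def p_def)
qed

lemma norm_mfun_sq:
  assumes "spectral A U a"
  shows "(norm (mfun g A))\<^sup>2 = (\<Sum>i\<in>UNIV. (g (a i))\<^sup>2)"
proof -
  have U: "adj U ** U = mat 1" "U ** adj U = mat 1"
    using assms by (auto simp: spectral_def)
  have "norm (mfun g A) = norm (rdiag (\<lambda>i. g (a i)))"
    using norm_isometry_right[of "adj U" "U ** rdiag (\<lambda>i. g (a i))"]
    by (simp add: mfun_eq[OF assms] norm_isometry_left U)
  then show ?thesis by (simp add: norm_rdiag_sq)
qed

lemma mfun_id: "hermitian A \<Longrightarrow> mfun (\<lambda>r. r) A = A"
  using hermitian_spectral[of A] mfun_eq by (fastforce simp: spectral_def)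

lemma spectral_uminus:
  assumes "spectral A U a" shows "spectral (- A) U (\<lambda>i. - a i)"
proof -
  have "rdiag (\<lambda>i. - a i) = - rdiag a" by (simp add: vec_eq_iff rdiag_def)
  moreover have "U ** (- rdiag a) ** adj U = - (U ** rdiag a ** adj U)"
    using matrix_diff_right[of U 0 "rdiag a"] matrix_diff_left[of 0 "U ** rdiag a" "adj U"] by simp
  ultimately show ?thesis using assms by (simp add: spectral_def)
qed

lemma mfun_odd:
  assumes "hermitian A" and odd: "\<And>r. g (- r) = - g r"
  shows "mfun g (- A) = - mfun g A"
proof -
  obtain U a where U: "spectral A U a" using hermitian_spectral[OF assms(1)] by blast
  have "rdiag (\<lambda>i. - g (a i)) = - rdiag (\<lambda>i. g (a i))" by (simp add: vec_eq_iff rdiag_def)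
  moreover have "U ** (- rdiag (\<lambda>i. g (a i))) ** adj U = - (U ** rdiag (\<lambda>i. g (a i)) ** adj U)"
    using matrix_diff_right[of U 0 "rdiag (\<lambda>i. g (a i))"]
      matrix_diff_left[of 0 "U ** rdiag (\<lambda>i. g (a i))" "adj U"] by simp
  ultimately show ?thesis
    by (simp add: mfun_eq[OF U] mfun_eq[OF spectral_uminus[OF U]] odd)
qed

lemma spectral_abs_le_norm:
  assumes "spectral A U a" "hermitian A"
  shows "\<bar>a i\<bar> \<le> norm A"
proof -
  have "(a i)\<^sup>2 \<le> (\<Sum>i\<in>UNIV. (a i)\<^sup>2)" by (rule member_le_sum) auto
  also have "\<dots> = (norm A)\<^sup>2"
    using norm_mfun_sq[OF assms(1), of "\<lambda>r. r"] mfun_id[OF assms(2)] by simp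
  finally show ?thesis using abs_le_square_iff[of "a i" "norm A"] by simp
qed

lemma norm_mfun_diff_le:
  assumes "hermitian A" "hermitian B"
    and g: "\<And>r s. (g r - g s)\<^sup>2 \<le> (r - s)\<^sup>2 * (((c r)\<^sup>2 + (c s)\<^sup>2) / 2)"
  shows "(norm (mfun g A - mfun g B))\<^sup>2
    \<le> ((norm ((A - B) ** mfun c A))\<^sup>2 + (norm ((A - B) ** mfun c B))\<^sup>2) / 2"
proof -
  obtain U a V b where UV: "spectral A U a" "spectral B V b"
    using hermitian_spectral assms by metis
  have "(norm (mfun g A - mfun g B))\<^sup>2
      = (\<Sum>i\<in>UNIV. \<Sum>j\<in>UNIV. (g (a i) - g (b j))\<^sup>2 * overlap U V i j)"
    by (simp add: mfun_eq[OF UV(1)] mfun_eq[OF UV(2)] norm_diff_spectral[OF UV])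
  also have "\<dots> \<le> (\<Sum>i\<in>UNIV. \<Sum>j\<in>UNIV.
      ((a i - b j)\<^sup>2 * (((c (a i))\<^sup>2 + (c (b j))\<^sup>2) / 2)) * overlap U V i j)"
    by (intro sum_mono mult_right_mono g) auto
  also have "\<dots> = ((norm ((A - B) ** mfun c A))\<^sup>2 + (norm ((A - B) ** mfun c B))\<^sup>2) / 2"
    by (simp add: mfun_eq[OF UV(1)] mfun_eq[OF UV(2)] norm_diff_mult_spectral_left[OF UV]
        norm_diff_mult_spectral_right[OF UV] add_divide_distrib sum_divide_distrib
        algebra_simps flip: sum.distrib)
  finally show ?thesis .
qed

text \<open>The weighted expansion again, with eigenvalues confined to \<open>[-R, R]\<close>
  because \<open>sinh\<close>, \<open>cosh\<close> and \<open>exp\<close> are Lipschitz only on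
  bounded intervals.\<close>

lemma norm_mfun_lipschitz:
  assumes "hermitian A" "hermitian B" "norm A \<le> R" "norm B \<le> R" "0 \<le> L"
    and g: "\<And>r s. \<bar>r\<bar> \<le> R \<Longrightarrow> \<bar>s\<bar> \<le> R \<Longrightarrow> \<bar>g r - g s\<bar> \<le> L * \<bar>r - s\<bar>"
  shows "norm (mfun g A - mfun g B) \<le> L * norm (A - B)"
proof -
  obtain U a V b where UV: "spectral A U a" "spectral B V b"
    using hermitian_spectral assms by metis
  have ab: "\<bar>a i\<bar> \<le> R" "\<bar>b i\<bar> \<le> R" for i
    using spectral_abs_le_norm[OF UV(1), of i] spectral_abs_le_norm[OF UV(2), of i] assms by auto
  have "(g (a i) - g (b j))\<^sup>2 \<le> L\<^sup>2 * (a i - b j)\<^sup>2" for i j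
    using power_mono[OF g[OF ab(1)[of i] ab(2)[of j]], of 2] by (simp add: power_mult_distrib)
  then have "(norm (mfun g A - mfun g B))\<^sup>2
      \<le> (\<Sum>i\<in>UNIV. \<Sum>j\<in>UNIV. L\<^sup>2 * (a i - b j)\<^sup>2 * overlap U V i j)"
    unfolding mfun_eq[OF UV(1)] mfun_eq[OF UV(2)] norm_diff_spectral[OF UV]
    by (intro sum_mono mult_right_mono) auto
  also have "\<dots> = L\<^sup>2 * (norm (A - B))\<^sup>2"
    using norm_diff_spectral[OF UV, of a b] UV
    by (simp add: spectral_def sum_distrib_left mult.assoc)
  finally have "(norm (mfun g A - mfun g B))\<^sup>2 \<le> (L * norm (A - B))\<^sup>2"
    by (simp add: power_mult_distrib)
  then show ?thesis by (rule power2_le_imp_le) (simp add: assms)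
qed

section \<open>Continuity and measurability of functions of Hermitian matrices\<close>

lemma continuous_on_mfun:
  assumes g': "\<And>r. (g has_real_derivative g' r) (at r)" and cont: "continuous_on UNIV g'"
  shows "continuous_on {A. hermitian A \<and> norm A \<le> R} (mfun g)"
proof -
  have "compact (g' ` {-R..R})"
    by (rule compact_continuous_image) (auto intro: continuous_on_subset[OF cont])
  then obtain L where L: "\<And>r. r \<in> {-R..R} \<Longrightarrow> \<bar>g' r\<bar> \<le> L"
    using compact_imp_bounded bounded_real by (metis imageI)
  \<comment> \<open>For negative \<open>R\<close> the interval is empty and \<open>L\<close> may be
    negative, while a Lipschitz constant must not be; hence the maximum with 0.\<close>
  have lip: "\<bar>g r - g s\<bar> \<le> max L 0 * \<bar>r - s\<bar>" if "\<bar>r\<bar> \<le> R" "\<bar>s\<bar> \<le> R" for r s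
    using field_differentiable_bound[of "{-R..R}" g g' "max L 0" r s] that L
      DERIV_subset[OF g'] by (auto simp: abs_le_iff le_max_iff_disj)
  have "(max L 0)-lipschitz_on {A. hermitian A \<and> norm A \<le> R} (mfun g)"
    by (rule lipschitz_onI) (auto simp: dist_norm intro!: norm_mfun_lipschitz lip)
  then show ?thesis by (rule lipschitz_on_continuous_on)
qed

lemma hermitian_diff: "hermitian A \<Longrightarrow> hermitian B \<Longrightarrow> hermitian (A - B)"
  unfolding hermitian_def by (metis complex_cnj_diff vector_minus_component)

lemma hermitian_bounded_closed: "closed {A :: complex^'n^'n. hermitian A \<and> norm A \<le> R}"
  unfolding hermitian_def
  by (intro closed_Collect_conj closed_Collect_all closed_Collect_eq closed_Collect_le continuous_intros)

lemma borel_measurable_mfun: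
  assumes G: "G \<in> borel_measurable M"
    and herm: "\<And>x. x \<in> space M \<Longrightarrow> hermitian (G x)" "\<And>x. x \<in> space M \<Longrightarrow> norm (G x) \<le> R"
    and g': "\<And>r. (g has_real_derivative g' r) (at r)" "continuous_on UNIV g'"
  shows "(\<lambda>x. mfun g (G x)) \<in> borel_measurable M"
proof -
  let ?K = "{A. hermitian A \<and> norm A \<le> R}"
  have "G \<in> measurable M (restrict_space borel ?K)"
    using G herm by (intro measurable_restrict_space2) auto
  from measurable_compose[OF this borel_measurable_continuous_on_restrict[OF continuous_on_mfun[OF g']]]
  show ?thesis .
qed

text \<open>\<open>lambda_max\<close> is a \<open>Max\<close>, so its set must be shown finite and
  nonempty before it denotes an eigenvalue. In coordinates of an eigenbasis every eigenvalue is one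
  of the diagonal entries, and each column of \<open>U\<close> shows that its diagonal entry is an
  eigenvalue.\<close>

lemma lambda_max_eigenvector:
  fixes A :: "complex^'n^'n"
  assumes "hermitian A"
  shows "\<exists>u. norm u = 1 \<and> A *v u = complex_of_real (lambda_max A) *s u"
proof -
  obtain U a where U: "spectral A U a" using hermitian_spectral[OF assms] by blast
  then have U1: "adj U ** U = mat 1" "U ** adj U = mat 1" and A: "A = U ** rdiag a ** adj U"
    by (auto simp: spectral_def)
  let ?E = "{r. is_eigenvalue A (complex_of_real r)}"
  have AU: "A ** U = U ** rdiag a"
    by (simp add: A U1 flip: matrix_mul_assoc)
  have "adj U ** A = rdiag a ** adj U"
    by (simp add: A U1 matrix_mul_assoc)
  have sub: "?E \<subseteq> range a"
  proof
    fix r assume "r \<in> ?E"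
    then obtain u where u: "u \<noteq> 0" "A *v u = complex_of_real r *s u"
      by (auto simp: is_eigenvalue_def)
    define w where "w = adj U *v u"
    have "w \<noteq> 0"
      using u(1) norm_isometry_vec[of "adj U" u] U1 by (auto simp: w_def)
    then obtain i where i: "w $ i \<noteq> 0" by (auto simp: vec_eq_iff)
    have "rdiag a *v w = adj U *v (A *v u)"
      by (simp add: w_def matrix_vector_mul_assoc \<open>adj U ** A = rdiag a ** adj U\<close>)
    also have "\<dots> = complex_of_real r *s w"
      by (simp add: u(2) w_def vector_scalar_commute)
    finally have "(rdiag a *v w) $ i = complex_of_real r * w $ i" by simp
    then have "a i = r" using i by (simp add: rdiag_vector_nth)
    then show "r \<in> range a" by blast
  qed
  then have fin: "finite ?E" by (rule finite_subset) simp
  have "?E \<noteq> {}"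
  proof -
    fix i :: 'n
    have "A *v column i U = column i (U ** rdiag a)"
      using AU by (simp add: vec_eq_iff column_def matrix_vector_mult_def matrix_matrix_mult_def)
    also have "\<dots> = complex_of_real (a i) *s column i U"
      by (simp add: vec_eq_iff column_def mult_rdiag_nth)
    finally have eq: "A *v column i U = complex_of_real (a i) *s column i U" .
    have "(adj U ** U) $ i $ i = 1" by (simp add: U1 mat_def)
    then have "cip (column i U) (column i U) = 1"
      by (simp add: matrix_matrix_mult_def column_def cip_def)
    then have "column i U \<noteq> 0"
      by (auto simp: cip_def)
    with eq have "a i \<in> ?E" by (auto simp: is_eigenvalue_def)
    then show ?thesis by blast
  qed
  with fin have "lambda_max A \<in> ?E"
    unfolding lambda_max_def by (rule Max_in)
  then obtain u where u: "u \<noteq> 0" "A *v u = complex_of_real (lambda_max A) *s u"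
    by (auto simp: is_eigenvalue_def)
  then show ?thesis
    by (intro exI[of _ "complex_of_real (inverse (norm u)) *s u"])
      (simp add: norm_cvec_smult norm_inverse vector_scalar_commute vector_smult_assoc mult.commute)
qed

text \<open>The tangent line of \<open>exp\<close> at \<open>s\<close> serves simultaneously as Jensen's inequality in the
  spectral measure of \<open>A\<close> at \<open>u\<close> and, later, for an average over \<open>A\<close>.\<close>

lemma exp_tangent_le_norm_mfun:
  assumes A: "hermitian A" and u: "norm u = 1" and k: "0 \<le> k"
  shows "exp (2 * k * s) * (1 + 2 * k * (Re (cip u (A *v u)) - s)) \<le> (norm (mfun (\<lambda>r. exp (k * r)) A))\<^sup>2"
proof -
  obtain U a where U: "spectral A U a" using hermitian_spectral[OF A] by blast
  then have U1: "adj U ** U = mat 1" "U ** adj U = mat 1" and Aeq: "A = U ** rdiag a ** adj U"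
    by (auto simp: spectral_def)
  define w where "w = adj U *v u"
  define p where "p = (\<lambda>i. (cmod (w $ i))\<^sup>2)"
  have "norm w = 1" using norm_isometry_vec[of "adj U" u] U1 u by (simp add: w_def)
  then have p1: "(\<Sum>i\<in>UNIV. p i) = 1" using norm_vec_sq[of w] by (simp add: p_def)
  have p0: "0 \<le> p i" for i by (simp add: p_def)
  have ple: "p i \<le> 1" for i
    unfolding p1[symmetric] by (rule member_le_sum) (auto simp: p0)
  have "cip u (A *v u) = cip w (rdiag a *v w)"
    using cip_adj[of "adj U" u "rdiag a *v w"] by (simp add: Aeq w_def matrix_vector_mul_assoc matrix_mul_assoc)
  then have "Re (cip u (A *v u)) = (\<Sum>i\<in>UNIV. p i * a i)"
    by (simp add: cip_def[of w] rdiag_vector_nth p_def cmod_power2) (simp add: power2_eq_square algebra_simps)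
  then have "exp (2 * k * s) * (1 + 2 * k * (Re (cip u (A *v u)) - s))
      = exp (2 * k * s) * ((\<Sum>i\<in>UNIV. p i) + 2 * k * ((\<Sum>i\<in>UNIV. p i * a i) - (\<Sum>i\<in>UNIV. p i) * s))"
    by (simp add: p1)
  also have "\<dots> = (\<Sum>i\<in>UNIV. p i * (exp (2 * k * s) * (1 + 2 * k * (a i - s))))"
    by (simp add: sum_distrib_left sum_distrib_right sum_subtractf sum.distrib algebra_simps)
  also have "\<dots> \<le> (\<Sum>i\<in>UNIV. p i * exp (2 * k * a i))"
  proof (intro sum_mono mult_left_mono p0)
    fix i
    have "exp (2 * k * s) * (1 + 2 * k * (a i - s)) \<le> exp (2 * k * s) * exp (2 * k * (a i - s))"
      by (intro mult_left_mono) auto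
    then show "exp (2 * k * s) * (1 + 2 * k * (a i - s)) \<le> exp (2 * k * a i)"
      by (simp add: algebra_simps flip: exp_add)
  qed
  also have "\<dots> \<le> (\<Sum>i\<in>UNIV. exp (2 * k * a i))"
    by (intro sum_mono mult_left_le_one_le ple p0) auto
  also have "\<dots> = (norm (mfun (\<lambda>r. exp (k * r)) A))\<^sup>2"
    by (simp add: norm_mfun_sq[OF U] algebra_simps flip: exp_double)
  finally show ?thesis .
qed

text \<open>Eigenvalue-wise these are exp(2r) + exp(-2r) = 2 + 4 sinh^2 r and cosh^2 = 1 + sinh^2.
  The second closes the estimate of the sinh moment in terms of itself; the first turns that moment
  into the trace of the exponential.\<close>

lemma norm_mfun_exp_cosh_sinh:
  assumes A: "hermitian (A :: complex^'n^'n)"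
  shows "(norm (mfun (\<lambda>r. exp (k * r)) A))\<^sup>2 + (norm (mfun (\<lambda>r. exp (k * r)) (- A)))\<^sup>2
      = 2 * real CARD('n) + 4 * (norm (mfun (\<lambda>r. sinh (k * r)) A))\<^sup>2"
    and "(norm (mfun (\<lambda>r. k * cosh (k * r)) A))\<^sup>2
      = k\<^sup>2 * (real CARD('n) + (norm (mfun (\<lambda>r. sinh (k * r)) A))\<^sup>2)"
proof -
  obtain U a where U: "spectral A U a" using hermitian_spectral[OF A] by blast
  have "(exp r)\<^sup>2 + (exp (- r))\<^sup>2 = 2 + 4 * (sinh r)\<^sup>2" for r :: real
    by (simp add: sinh_field_def power2_eq_square field_simps flip: exp_add)
  then have "(\<Sum>i\<in>UNIV. (exp (k * a i))\<^sup>2 + (exp (- (k * a i)))\<^sup>2) = (\<Sum>i\<in>UNIV. 2 + 4 * (sinh (k * a i))\<^sup>2)"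
    by simp
  then show "(norm (mfun (\<lambda>r. exp (k * r)) A))\<^sup>2 + (norm (mfun (\<lambda>r. exp (k * r)) (- A)))\<^sup>2
      = 2 * real CARD('n) + 4 * (norm (mfun (\<lambda>r. sinh (k * r)) A))\<^sup>2"
    by (simp add: norm_mfun_sq[OF U] norm_mfun_sq[OF spectral_uminus[OF U]] sum.distrib sum_distrib_left)
  show "(norm (mfun (\<lambda>r. k * cosh (k * r)) A))\<^sup>2
      = k\<^sup>2 * (real CARD('n) + (norm (mfun (\<lambda>r. sinh (k * r)) A))\<^sup>2)"
    by (simp add: norm_mfun_sq[OF U] power_mult_distrib cosh_square_eq sum.distrib sum_distrib_left algebra_simps)
qed

section \<open>Scalar inequalities for the hyperbolic sine\<close>

lemma sinh_le_mult_cosh: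
  assumes "0 \<le> x" shows "sinh x \<le> x * cosh (x :: real)"
proof -
  have "(\<lambda>x. x * cosh x - sinh x) 0 \<le> (\<lambda>x. x * cosh x - sinh (x::real)) x"
    by (rule DERIV_nonneg_imp_nondecreasing[OF assms])
      (rule exI, rule conjI, (rule derivative_eq_intros refl | simp)+)
  then show ?thesis by simp
qed

text \<open>With half-difference \<delta> and midpoint \<sigma> the left side is 4 sinh^2 \<delta>
  cosh^2 \<sigma>. Then |tanh \<delta>| <= |\<delta>| leaves \<open>C + C * S\<close> against the
  exact average \<open>C + (2 * C - 1) * S\<close> of the squared cosines, and
  \<open>C \<ge> 1\<close>.\<close>

lemma sinh_diff_sq_le:
  "(sinh a - sinh b)\<^sup>2 \<le> (a - b)\<^sup>2 * (((cosh a)\<^sup>2 + (cosh b)\<^sup>2) / 2)" for a b :: real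
proof -
  define \<delta> \<sigma> where "\<delta> = (a - b) / 2" and "\<sigma> = (a + b) / 2"
  have a: "a = \<sigma> + \<delta>" and b: "b = \<sigma> - \<delta>" by (simp_all add: \<delta>_def \<sigma>_def field_simps)
  define S C where "S = (sinh \<delta>)\<^sup>2" and "C = (cosh \<sigma>)\<^sup>2"
  have C1: "C \<ge> 1" using cosh_real_ge_1[of \<sigma>] by (simp add: C_def)
  have S0: "S \<ge> 0" by (simp add: S_def)
  have "\<bar>sinh \<delta>\<bar> \<le> \<bar>\<delta>\<bar> * cosh \<delta>"
    using sinh_le_mult_cosh[of \<delta>] sinh_le_mult_cosh[of "- \<delta>"] by (cases "\<delta> \<ge> 0") auto
  from power_mono[OF this, of 2] have S: "S \<le> \<delta>\<^sup>2 * (1 + S)"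
    by (simp add: S_def power_mult_distrib cosh_square_eq add.commute)
  have "(sinh a - sinh b)\<^sup>2 = 4 * (S * C)"
    by (simp add: a b sinh_add sinh_diff S_def C_def power2_eq_square algebra_simps)
  also have "S * C \<le> \<delta>\<^sup>2 * (1 + S) * C" using S C1 by (intro mult_right_mono) auto
  also have "\<delta>\<^sup>2 * (1 + S) * C = \<delta>\<^sup>2 * (C + C * S)" by (simp add: algebra_simps)
  also have "\<dots> \<le> \<delta>\<^sup>2 * (C + (2 * C - 1) * S)"
    using C1 S0 by (intro mult_left_mono add_left_mono mult_right_mono) auto
  also have "C + (2 * C - 1) * S = ((cosh a)\<^sup>2 + (cosh b)\<^sup>2) / 2"
  proof -
    have e: "((cosh a)\<^sup>2 + (cosh b)\<^sup>2) / 2 = C * (cosh \<delta>)\<^sup>2 + (sinh \<sigma>)\<^sup>2 * S"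
      by (simp add: a b cosh_add cosh_diff S_def C_def power2_eq_square field_simps)
    show ?thesis unfolding e
      by (simp add: cosh_square_eq[of \<delta>] sinh_square_eq[of \<sigma>] S_def[symmetric] C_def[symmetric] algebra_simps)
  qed
  finally have "(sinh a - sinh b)\<^sup>2 \<le> 4 * (\<delta>\<^sup>2 * (((cosh a)\<^sup>2 + (cosh b)\<^sup>2) / 2))" by simp
  then show ?thesis by (simp add: \<delta>_def power_divide)
qed

section \<open>The Efron--Stein inequality\<close>

text \<open>The bound holds at every point, not just almost everywhere. The class is therefore
  closed under slicing, substitution and partial integration, and its members are integrable for
  every probability measure, which supplies the side conditions of all later uses of Fubini.\<close>

definition bdd_measurable :: "'a measure \<Rightarrow> ('a \<Rightarrow> 'b::euclidean_space) \<Rightarrow> bool" where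
  "bdd_measurable M h \<longleftrightarrow> h \<in> borel_measurable M \<and> (\<exists>B. \<forall>x\<in>space M. norm (h x) \<le> B)"

lemma bdd_measurableI: "h \<in> borel_measurable M \<Longrightarrow> (\<And>x. x \<in> space M \<Longrightarrow> norm (h x) \<le> B) \<Longrightarrow> bdd_measurable M h"
  by (auto simp: bdd_measurable_def)

lemma bdd_measurableD: "bdd_measurable M h \<Longrightarrow> h \<in> borel_measurable M"
  by (simp add: bdd_measurable_def)

lemma bdd_measurable_integrable:
  assumes "prob_space M" "bdd_measurable M h" shows "integrable M h"
proof -
  interpret prob_space M by fact
  obtain B where B: "\<And>x. x \<in> space M \<Longrightarrow> norm (h x) \<le> B" using assms(2) by (auto simp: bdd_measurable_def)
  show ?thesis
    by (rule integrable_const_bound[of _ B]) (use B assms(2) in \<open>auto simp: bdd_measurable_def\<close>)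
qed

lemma bdd_measurable_compose:
  assumes "bdd_measurable M h" "T \<in> measurable N M"
  shows "bdd_measurable N (\<lambda>x. h (T x))"
  using assms measurable_compose[OF assms(2), of h borel] measurable_space[OF assms(2)]
  unfolding bdd_measurable_def by blast

lemma bdd_measurable_const: "bdd_measurable M (\<lambda>_. c)"
  by (rule bdd_measurableI) auto

lemma bdd_measurable_diff:
  assumes "bdd_measurable M g" "bdd_measurable M h" shows "bdd_measurable M (\<lambda>x. g x - h x)"
proof -
  obtain B C where "\<And>x. x \<in> space M \<Longrightarrow> norm (g x) \<le> B" "\<And>x. x \<in> space M \<Longrightarrow> norm (h x) \<le> C"
    using assms by (auto simp: bdd_measurable_def)
  then show ?thesis
    using assms by (intro bdd_measurableI[where B = "B + C"]) (auto simp: bdd_measurable_def intro: norm_triangle_le_diff add_mono)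
qed

lemma bdd_measurable_add:
  assumes "bdd_measurable M g" "bdd_measurable M h" shows "bdd_measurable M (\<lambda>x. g x + h x)"
  using bdd_measurable_diff[OF assms(1) bdd_measurable_diff[OF bdd_measurable_const[of M 0] assms(2)]] by simp

lemma bdd_measurable_norm_sq:
  assumes "bdd_measurable M h" shows "bdd_measurable M (\<lambda>x. (norm (h x))\<^sup>2)"
proof -
  obtain B where "\<And>x. x \<in> space M \<Longrightarrow> norm (h x) \<le> B" using assms by (auto simp: bdd_measurable_def)
  then show ?thesis
    using assms by (intro bdd_measurableI[where B = "B\<^sup>2"]) (auto simp: bdd_measurable_def intro: power_mono)
qed

lemma bdd_measurable_mult_left: "bdd_measurable M h \<Longrightarrow> bdd_measurable M (\<lambda>x. c * h x)" for h :: "_ \<Rightarrow> real"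
  unfolding bdd_measurable_def
proof (elim conjE exE, intro conjI exI)
  fix B assume B: "\<forall>x\<in>space M. norm (h x) \<le> B"
  show "\<forall>x\<in>space M. norm (c * h x) \<le> \<bar>c\<bar> * B"
    using B by (auto simp: abs_mult mult_left_mono)
qed measurable

lemma bdd_measurable_Pair1: "bdd_measurable (M \<Otimes>\<^sub>M N) h \<Longrightarrow> x \<in> space M \<Longrightarrow> bdd_measurable N (\<lambda>y. h (x, y))"
  by (erule bdd_measurable_compose) (rule measurable_Pair1')

lemma bdd_measurable_Pair2: "bdd_measurable (M \<Otimes>\<^sub>M N) h \<Longrightarrow> y \<in> space N \<Longrightarrow> bdd_measurable M (\<lambda>x. h (x, y))"
  by (erule bdd_measurable_compose) (rule measurable_Pair2')

lemma bdd_measurable_swap: "bdd_measurable (M \<Otimes>\<^sub>M N) h \<Longrightarrow> bdd_measurable (N \<Otimes>\<^sub>M M) (\<lambda>p. h (snd p, fst p))"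
  by (erule bdd_measurable_compose) measurable

lemma bdd_measurable_integral:
  assumes "prob_space N" and h: "bdd_measurable (M \<Otimes>\<^sub>M N) h"
  shows "bdd_measurable M (\<lambda>x. \<integral>y. h (x, y) \<partial>N)"
proof -
  interpret N: prob_space N by fact
  obtain B where B: "\<And>p. p \<in> space (M \<Otimes>\<^sub>M N) \<Longrightarrow> norm (h p) \<le> B" using h by (auto simp: bdd_measurable_def)
  show ?thesis
  proof (rule bdd_measurableI[where B = "max B 0"])
    show "(\<lambda>x. \<integral>y. h (x, y) \<partial>N) \<in> borel_measurable M"
      using bdd_measurableD[OF h] by (intro N.borel_measurable_lebesgue_integral) simp
    fix x assume x: "x \<in> space M"
    have "norm (\<integral>y. h (x, y) \<partial>N) \<le> (\<integral>y. norm (h (x, y)) \<partial>N)" by (rule integral_norm_bound)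
    also have "\<dots> \<le> (\<integral>y. max B 0 \<partial>N)"
      using bdd_measurable_integrable[OF N.prob_space_axioms bdd_measurable_Pair1[OF h x]] B x
      by (intro integral_mono) (auto simp: space_pair_measure le_max_iff_disj)
    finally show "norm (\<integral>y. h (x, y) \<partial>N) \<le> max B 0" by (simp add: N.prob_space)
  qed
qed

lemma bdd_measurable_integral2:
  assumes "prob_space M" and h: "bdd_measurable (M \<Otimes>\<^sub>M N) h"
  shows "bdd_measurable N (\<lambda>y. \<integral>x. h (x, y) \<partial>M)"
  using bdd_measurable_integral[OF assms(1) bdd_measurable_swap[OF h]] by simp

lemma bdd_measurable_fubini:
  assumes "prob_space M" "prob_space N" and h: "bdd_measurable (M \<Otimes>\<^sub>M N) h"
  shows "(\<integral>x. \<integral>y. h (x, y) \<partial>N \<partial>M) = (\<integral>y. \<integral>x. h (x, y) \<partial>M \<partial>N)"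
proof -
  interpret M: prob_space M by fact
  interpret N: prob_space N by fact
  interpret pair_sigma_finite M N ..
  have "integrable (M \<Otimes>\<^sub>M N) h"
    by (rule bdd_measurable_integrable[OF prob_space_pair h]) fact+
  then show ?thesis using Fubini_integral[of "\<lambda>x y. h (x, y)"] by simp
qed

section \<open>Variance of functions with values in a Euclidean space\<close>

definition var :: "'a measure \<Rightarrow> ('a \<Rightarrow> 'b::euclidean_space) \<Rightarrow> real" where
  "var M h = (\<integral>x. (norm (h x))\<^sup>2 \<partial>M) - (norm (\<integral>x. h x \<partial>M))\<^sup>2"

lemma integral_norm_sq_diff_const:
  assumes "prob_space M" "bdd_measurable M h"
  shows "(\<integral>x. (norm (h x - c))\<^sup>2 \<partial>M)
    = (\<integral>x. (norm (h x))\<^sup>2 \<partial>M) - 2 * ((\<integral>x. h x \<partial>M) \<bullet> c) + (norm c)\<^sup>2"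
proof -
  interpret prob_space M by fact
  have "integrable M h" "integrable M (\<lambda>x. (norm (h x))\<^sup>2)"
    using assms bdd_measurable_integrable bdd_measurable_norm_sq by blast+
  moreover have "(norm (h x - c))\<^sup>2 = (norm (h x))\<^sup>2 - 2 * (h x \<bullet> c) + (norm c)\<^sup>2" for x
    by (simp add: power2_norm_eq_inner inner_diff_left inner_diff_right inner_commute[of c "h x"])
  ultimately show ?thesis by (simp add: prob_space)
qed

lemma var_eq:
  assumes "prob_space M" "bdd_measurable M h"
  shows "var M h = (\<integral>x. (norm (h x - (\<integral>y. h y \<partial>M)))\<^sup>2 \<partial>M)"
  unfolding var_def integral_norm_sq_diff_const[OF assms] by (simp add: power2_norm_eq_inner)

lemma norm_integral_sq_le:
  assumes "prob_space M" "bdd_measurable M h"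
  shows "(norm (\<integral>x. h x \<partial>M))\<^sup>2 \<le> (\<integral>x. (norm (h x))\<^sup>2 \<partial>M)"
proof -
  have "0 \<le> var M h" unfolding var_eq[OF assms] by (rule Bochner_Integration.integral_nonneg) simp
  then show ?thesis by (simp add: var_def)
qed

lemma var_eq_pair:
  assumes "prob_space M" "bdd_measurable M h"
  shows "var M h = (\<integral>x. \<integral>z. (norm (h x - h z))\<^sup>2 \<partial>M \<partial>M) / 2"
proof -
  interpret prob_space M by fact
  have int: "integrable M h" "integrable M (\<lambda>x. (norm (h x))\<^sup>2)"
    using assms bdd_measurable_integrable bdd_measurable_norm_sq by blast+
  have "(\<integral>z. (norm (h x - h z))\<^sup>2 \<partial>M)
    = (\<integral>x. (norm (h x))\<^sup>2 \<partial>M) - 2 * ((\<integral>x. h x \<partial>M) \<bullet> h x) + (norm (h x))\<^sup>2" for x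
    using integral_norm_sq_diff_const[OF assms, of "h x"] by (simp add: norm_minus_commute)
  then show ?thesis
    using int by (simp add: var_def prob_space power2_norm_eq_inner)
qed

text \<open>Subadditivity of variance over two independent factors. The total variance is the mean
  variance in \<open>y\<close> plus the variance of the partial mean \<open>p\<close>; since
  \<open>p x - m\<close> averages \<open>k (x, y) - q y\<close> over \<open>y\<close>, Jensen bounds
  the latter by the mean variance in \<open>x\<close>.\<close>

lemma var_pair_le:
  assumes M: "prob_space M" and N: "prob_space N" and k: "bdd_measurable (M \<Otimes>\<^sub>M N) k"
  shows "(\<integral>x. \<integral>y. (norm (k (x, y)))\<^sup>2 \<partial>N \<partial>M) - (norm (\<integral>x. \<integral>y. k (x, y) \<partial>N \<partial>M))\<^sup>2
    \<le> (\<integral>y. var M (\<lambda>x. k (x, y)) \<partial>N) + (\<integral>x. var N (\<lambda>y. k (x, y)) \<partial>M)"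
proof -
  interpret M: prob_space M by fact
  interpret N: prob_space N by fact
  define p where "p = (\<lambda>x. \<integral>y. k (x, y) \<partial>N)"
  define q where "q = (\<lambda>y. \<integral>x. k (x, y) \<partial>M)"
  define m where "m = (\<integral>x. p x \<partial>M)"
  have p: "bdd_measurable M p" unfolding p_def by (rule bdd_measurable_integral[OF N k])
  have q: "bdd_measurable N q" unfolding q_def by (rule bdd_measurable_integral2[OF M k])
  have k2: "bdd_measurable (M \<Otimes>\<^sub>M N) (\<lambda>r. (norm (k r))\<^sup>2)" by (rule bdd_measurable_norm_sq[OF k])
  have mq: "m = (\<integral>y. q y \<partial>N)" unfolding m_def p_def q_def by (rule bdd_measurable_fubini[OF M N k])
  have kq: "bdd_measurable (M \<Otimes>\<^sub>M N) (\<lambda>r. k r - q (snd r))"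
    by (intro bdd_measurable_diff k bdd_measurable_compose[OF q]) measurable
  have kq2: "bdd_measurable (M \<Otimes>\<^sub>M N) (\<lambda>r. (norm (k r - q (snd r)))\<^sup>2)" by (rule bdd_measurable_norm_sq[OF kq])
  have "(\<integral>x. (norm (p x))\<^sup>2 \<partial>M) - (norm m)\<^sup>2 = (\<integral>x. (norm (p x - m))\<^sup>2 \<partial>M)"
    using var_eq[OF M p] by (simp add: var_def m_def)
  also have "\<dots> \<le> (\<integral>x. \<integral>y. (norm (k (x, y) - q y))\<^sup>2 \<partial>N \<partial>M)"
  proof (rule integral_mono)
    show "integrable M (\<lambda>x. (norm (p x - m))\<^sup>2)"
      by (intro bdd_measurable_integrable[OF M] bdd_measurable_norm_sq bdd_measurable_diff p bdd_measurable_const)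
    show "integrable M (\<lambda>x. \<integral>y. (norm (k (x, y) - q y))\<^sup>2 \<partial>N)"
      using bdd_measurable_integrable[OF M bdd_measurable_integral[OF N kq2]] by simp
    fix x assume x: "x \<in> space M"
    have "p x - m = (\<integral>y. k (x, y) - q y \<partial>N)"
      unfolding mq p_def
      by (rule Bochner_Integration.integral_diff[symmetric])
        (intro bdd_measurable_integrable[OF N] bdd_measurable_Pair1[OF k x] q)+
    then show "(norm (p x - m))\<^sup>2 \<le> (\<integral>y. (norm (k (x, y) - q y))\<^sup>2 \<partial>N)"
      using norm_integral_sq_le[OF N bdd_measurable_Pair1[OF kq x]] by simp
  qed
  also have "\<dots> = (\<integral>y. \<integral>x. (norm (k (x, y) - q y))\<^sup>2 \<partial>M \<partial>N)"
    using bdd_measurable_fubini[OF M N kq2] by simp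
  also have "\<dots> = (\<integral>y. var M (\<lambda>x. k (x, y)) \<partial>N)"
    by (intro Bochner_Integration.integral_cong refl)
      (simp add: var_eq[OF M bdd_measurable_Pair2[OF k]] q_def)
  finally have "(\<integral>x. (norm (p x))\<^sup>2 \<partial>M) - (norm m)\<^sup>2 \<le> (\<integral>y. var M (\<lambda>x. k (x, y)) \<partial>N)" .
  moreover have "(\<integral>x. var N (\<lambda>y. k (x, y)) \<partial>M)
      = (\<integral>x. \<integral>y. (norm (k (x, y)))\<^sup>2 \<partial>N \<partial>M) - (\<integral>x. (norm (p x))\<^sup>2 \<partial>M)"
    unfolding var_def p_def
    by (intro Bochner_Integration.integral_diff bdd_measurable_integrable[OF M] bdd_measurable_integral[OF N k2] bdd_measurable_norm_sq
        p[unfolded p_def])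
  ultimately show ?thesis by (simp add: m_def p_def)
qed

lemma integral_PiM_insert:
  assumes "\<And>i. prob_space (\<mu> i)" "finite J" "j \<notin> J" "bdd_measurable (PiM (insert j J) \<mu>) h"
  shows "(\<integral>x. h x \<partial>PiM (insert j J) \<mu>) = (\<integral>x. \<integral>a. h (x(j := a)) \<partial>\<mu> j \<partial>PiM J \<mu>)"
proof -
  interpret product_sigma_finite \<mu>
    by (rule product_sigma_finite.intro) (rule prob_space_imp_sigma_finite[OF assms(1)])
  show ?thesis
    by (rule product_integral_insert[OF assms(2,3) bdd_measurable_integrable[OF prob_space_PiM assms(4)]])
      (rule assms(1))
qed

lemma measurable_upd: "i \<in> I \<Longrightarrow> (\<lambda>p. (fst p)(i := snd p)) \<in> measurable (PiM I \<mu> \<Otimes>\<^sub>M \<mu> i) (PiM I \<mu>)"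
  using measurable_add_dim[where I = I and M = \<mu> and i = i] by (simp add: insert_absorb case_prod_beta)

lemma measurable_upd_insert:
  "(\<lambda>p. (fst p)(i := snd p)) \<in> measurable (PiM I \<mu> \<Otimes>\<^sub>M \<mu> i) (PiM (insert i I) \<mu>)"
  using measurable_add_dim[where I = I and M = \<mu> and i = i] by (simp add: case_prod_beta)

lemma measurable_upd_fst:
  "i \<in> I \<Longrightarrow> (\<lambda>p. (fst (fst p))(i := snd p)) \<in> measurable ((PiM I \<mu> \<Otimes>\<^sub>M N) \<Otimes>\<^sub>M \<mu> i) (PiM I \<mu>)"
  using measurable_compose[OF measurable_Pair[OF measurable_compose[OF measurable_fst measurable_fst]
      measurable_snd] measurable_upd, of i I \<mu> N] by simp

lemma bdd_measurable_sq_diff_upd: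
  assumes "i \<in> I" and h: "bdd_measurable (PiM I \<mu>) h"
  shows "bdd_measurable (PiM I \<mu> \<Otimes>\<^sub>M \<mu> i) (\<lambda>p. (norm (h (fst p) - h ((fst p)(i := snd p))))\<^sup>2)"
  by (intro bdd_measurable_norm_sq bdd_measurable_diff bdd_measurable_compose[OF h] measurable_upd assms(1) measurable_fst)

text \<open>Induction on the coordinates, for all \<open>h\<close> at once because the induction
  hypothesis is applied to slices. \<open>var_pair_le\<close> separates coordinate \<open>j\<close>
  from the rest; its own variance is half the mean square distance of two independent copies, which
  is exactly its resampling term.\<close>

theorem efron_stein:
  assumes \<mu>: "\<And>i. prob_space (\<mu> i)" and "finite I" and "bdd_measurable (PiM I \<mu>) h"
  shows "var (PiM I \<mu>) h \<le> (\<Sum>i\<in>I. \<integral>x. \<integral>z. (norm (h x - h (x(i := z))))\<^sup>2 \<partial>\<mu> i \<partial>PiM I \<mu>) / 2"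
  using assms(2,3)
proof (induction I arbitrary: h rule: finite_induct)
  case empty
  show ?case by (simp add: var_def PiM_empty lebesgue_integral_count_space_finite)
next
  case (insert j J)
  note h = insert.prems
  let ?P = "PiM J \<mu>" and ?Q = "PiM (insert j J) \<mu>"
  have P: "prob_space ?P" and Q: "prob_space ?Q" by (auto intro: prob_space_PiM \<mu>)
  define k where "k = (\<lambda>p. h ((fst p)(j := snd p)))"
  have k: "bdd_measurable (?P \<Otimes>\<^sub>M \<mu> j) k"
    unfolding k_def by (rule bdd_measurable_compose[OF h measurable_upd_insert])
  note split = integral_PiM_insert[OF \<mu> insert.hyps]
  have "var ?Q h = (\<integral>x. \<integral>y. (norm (k (x, y)))\<^sup>2 \<partial>\<mu> j \<partial>?P) - (norm (\<integral>x. \<integral>y. k (x, y) \<partial>\<mu> j \<partial>?P))\<^sup>2"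
    unfolding var_def split[OF h] split[OF bdd_measurable_norm_sq[OF h]] k_def by simp
  also have "\<dots> \<le> (\<integral>a. var ?P (\<lambda>x. k (x, a)) \<partial>\<mu> j) + (\<integral>x. var (\<mu> j) (\<lambda>a. k (x, a)) \<partial>?P)"
    by (rule var_pair_le[OF P \<mu> k])
  also have "(\<integral>x. var (\<mu> j) (\<lambda>a. k (x, a)) \<partial>?P)
      = (\<integral>x. \<integral>a. \<integral>z. (norm (k (x, a) - k (x, z)))\<^sup>2 \<partial>\<mu> j \<partial>\<mu> j \<partial>?P) / 2"
    by (subst Bochner_Integration.integral_divide_zero[symmetric], intro Bochner_Integration.integral_cong refl)
      (simp add: var_eq_pair[OF \<mu> bdd_measurable_Pair1[OF k]])
  also have "\<dots> = (\<integral>x. \<integral>z. (norm (h x - h (x(j := z))))\<^sup>2 \<partial>\<mu> j \<partial>?Q) / 2"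
    using split[OF bdd_measurable_integral[OF \<mu> bdd_measurable_sq_diff_upd[of j "insert j J", OF _ h]]] by (simp add: k_def del: fun_upd_apply)
  also have "(\<integral>a. var ?P (\<lambda>x. k (x, a)) \<partial>\<mu> j)
      \<le> (\<Sum>i\<in>J. \<integral>x. \<integral>z. (norm (h x - h (x(i := z))))\<^sup>2 \<partial>\<mu> i \<partial>?Q) / 2"
  proof -
    \<comment> \<open>The resampling term of a coordinate \<open>i\<close> of \<open>J\<close>, kept
      as a joint function of the remaining coordinates and the value at \<open>j\<close>. This
      allows the induction hypothesis for each frozen value at \<open>j\<close> to be integrated
      over that value.\<close>
    define d where "d i = (\<lambda>p. \<integral>z. (norm (k p - k ((fst p)(i := z), snd p)))\<^sup>2 \<partial>\<mu> i)" for i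
    have kd: "bdd_measurable ((?P \<Otimes>\<^sub>M \<mu> j) \<Otimes>\<^sub>M \<mu> i)
        (\<lambda>r. (norm (k (fst r) - k ((fst (fst r))(i := snd r), snd (fst r))))\<^sup>2)" if "i \<in> J" for i
      using that
      by (intro bdd_measurable_norm_sq bdd_measurable_diff bdd_measurable_compose[OF k] measurable_Pair measurable_upd_fst) measurable
    have d: "bdd_measurable (?P \<Otimes>\<^sub>M \<mu> j) (d i)" if "i \<in> J" for i
      using bdd_measurable_integral[OF \<mu> kd[OF that]] unfolding d_def by simp
    have d2: "bdd_measurable (\<mu> j) (\<lambda>a. \<integral>x. d i (x, a) \<partial>?P)" if "i \<in> J" for i
      by (rule bdd_measurable_integral2[OF P d[OF that]])
    have vb: "bdd_measurable (\<mu> j) (\<lambda>a. var ?P (\<lambda>x. k (x, a)))"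
      unfolding var_def
      by (intro bdd_measurable_diff bdd_measurable_norm_sq bdd_measurable_integral2[OF P] bdd_measurable_integral2[OF P bdd_measurable_norm_sq[OF k]] k)
    have "(\<integral>a. var ?P (\<lambda>x. k (x, a)) \<partial>\<mu> j) \<le> (\<integral>a. (\<Sum>i\<in>J. \<integral>x. d i (x, a) \<partial>?P) / 2 \<partial>\<mu> j)"
    proof (rule integral_mono)
      show "integrable (\<mu> j) (\<lambda>a. var ?P (\<lambda>x. k (x, a)))" by (rule bdd_measurable_integrable[OF \<mu> vb])
      show "integrable (\<mu> j) (\<lambda>a. (\<Sum>i\<in>J. \<integral>x. d i (x, a) \<partial>?P) / 2)"
        by (intro integrable_divide Bochner_Integration.integrable_sum bdd_measurable_integrable[OF \<mu> d2]) auto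
      fix a assume a: "a \<in> space (\<mu> j)"
      show "var ?P (\<lambda>x. k (x, a)) \<le> (\<Sum>i\<in>J. \<integral>x. d i (x, a) \<partial>?P) / 2"
        using insert.IH[OF bdd_measurable_Pair2[OF k a]] by (simp add: d_def del: fun_upd_apply)
    qed
    also have "\<dots> = (\<Sum>i\<in>J. \<integral>a. \<integral>x. d i (x, a) \<partial>?P \<partial>\<mu> j) / 2"
      by (simp add: Bochner_Integration.integral_sum bdd_measurable_integrable[OF \<mu> d2] del: fun_upd_apply)
    also have "(\<Sum>i\<in>J. \<integral>a. \<integral>x. d i (x, a) \<partial>?P \<partial>\<mu> j)
        = (\<Sum>i\<in>J. \<integral>x. \<integral>z. (norm (h x - h (x(i := z))))\<^sup>2 \<partial>\<mu> i \<partial>?Q)"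
    proof (intro sum.cong refl)
      fix i assume i: "i \<in> J"
      then have "i \<noteq> j" using insert.hyps by auto
      have "(\<integral>x. \<integral>z. (norm (h x - h (x(i := z))))\<^sup>2 \<partial>\<mu> i \<partial>?Q)
          = (\<integral>x. \<integral>a. \<integral>z. (norm (h (x(j := a)) - h (x(j := a, i := z))))\<^sup>2 \<partial>\<mu> i \<partial>\<mu> j \<partial>?P)"
        using split[OF bdd_measurable_integral[OF \<mu> bdd_measurable_sq_diff_upd[of i "insert j J", OF _ h]]] i by (simp del: fun_upd_apply)
      also have "\<dots> = (\<integral>x. \<integral>a. d i (x, a) \<partial>\<mu> j \<partial>?P)"
        by (simp add: d_def k_def fun_upd_twist[OF \<open>i \<noteq> j\<close>] del: fun_upd_apply)
      also have "\<dots> = (\<integral>a. \<integral>x. d i (x, a) \<partial>?P \<partial>\<mu> j)"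
        by (rule bdd_measurable_fubini[OF P \<mu> d[OF i]])
      finally show "(\<integral>a. \<integral>x. d i (x, a) \<partial>?P \<partial>\<mu> j)
          = (\<integral>x. \<integral>z. (norm (h x - h (x(i := z))))\<^sup>2 \<partial>\<mu> i \<partial>?Q)" by simp
    qed
    finally show ?thesis .
  qed
  finally show ?case using insert.hyps by (simp add: add_divide_distrib del: fun_upd_apply)
qed

text \<open>The old and the new value of coordinate \<open>i\<close> are independent with the same
  law. Splitting off that coordinate makes both sides double integrals over these two values, in
  opposite orders, and Fubini identifies them.\<close>

lemma integral_exchange_coordinate:
  fixes \<Phi> :: "_ \<Rightarrow> 'c::euclidean_space"
  assumes \<mu>: "\<And>i. prob_space (\<mu> i)" and I: "finite I" "i \<in> I"
    and \<Phi>: "bdd_measurable (PiM I \<mu> \<Otimes>\<^sub>M PiM I \<mu>) \<Phi>"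
  shows "(\<integral>x. \<integral>z. \<Phi> (x, x(i := z)) \<partial>\<mu> i \<partial>PiM I \<mu>) = (\<integral>x. \<integral>z. \<Phi> (x(i := z), x) \<partial>\<mu> i \<partial>PiM I \<mu>)"
proof -
  define J where "J = I - {i}"
  have J: "I = insert i J" "finite J" "i \<notin> J" using I by (auto simp: J_def)
  let ?P = "PiM J \<mu>"
  note upd = measurable_upd[OF I(2), of \<mu>]
  have b1: "bdd_measurable (PiM I \<mu> \<Otimes>\<^sub>M \<mu> i) (\<lambda>p. \<Phi> (fst p, (fst p)(i := snd p)))"
    by (intro bdd_measurable_compose[OF \<Phi>] measurable_Pair upd measurable_fst)
  have b2: "bdd_measurable (PiM I \<mu> \<Otimes>\<^sub>M \<mu> i) (\<lambda>p. \<Phi> ((fst p)(i := snd p), fst p))"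
    by (intro bdd_measurable_compose[OF \<Phi>] measurable_Pair upd measurable_fst)
  have ins: "(\<lambda>a. w(i := a)) \<in> measurable (\<mu> i) (PiM I \<mu>)" if "w \<in> space ?P" for w
    using measurable_compose[OF measurable_Pair1'[OF that] measurable_upd_insert[of i J \<mu>]] J by (simp del: fun_upd_apply)
  have b3: "bdd_measurable (\<mu> i \<Otimes>\<^sub>M \<mu> i) (\<lambda>p. \<Phi> (w(i := fst p), w(i := snd p)))" if "w \<in> space ?P" for w
    by (intro bdd_measurable_compose[OF \<Phi>] measurable_Pair measurable_compose[OF measurable_fst ins[OF that]]
        measurable_compose[OF measurable_snd ins[OF that]])
  have "(\<integral>x. \<integral>z. \<Phi> (x, x(i := z)) \<partial>\<mu> i \<partial>PiM I \<mu>)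
      = (\<integral>w. \<integral>a. \<integral>z. \<Phi> (w(i := a), w(i := z)) \<partial>\<mu> i \<partial>\<mu> i \<partial>?P)"
    using integral_PiM_insert[OF \<mu> J(2,3), where h = "\<lambda>x. \<integral>z. \<Phi> (x, x(i := z)) \<partial>\<mu> i"]
      bdd_measurable_integral[OF \<mu> b1] by (simp add: J(1)[symmetric] del: fun_upd_apply)
  also have "\<dots> = (\<integral>w. \<integral>z. \<integral>a. \<Phi> (w(i := a), w(i := z)) \<partial>\<mu> i \<partial>\<mu> i \<partial>?P)"
    by (rule Bochner_Integration.integral_cong[OF refl]) (use bdd_measurable_fubini[OF \<mu> \<mu> b3] in \<open>simp del: fun_upd_apply\<close>)
  also have "\<dots> = (\<integral>x. \<integral>z. \<Phi> (x(i := z), x) \<partial>\<mu> i \<partial>PiM I \<mu>)"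
    using integral_PiM_insert[OF \<mu> J(2,3), where h = "\<lambda>x. \<integral>z. \<Phi> (x(i := z), x) \<partial>\<mu> i"]
      bdd_measurable_integral[OF \<mu> b2] by (simp add: J(1)[symmetric] del: fun_upd_apply)
  finally show ?thesis .
qed

section \<open>Concentration of the largest eigenvalue\<close>

lemma norm_mat1_sq: "(norm (mat 1 :: complex^'n^'n))\<^sup>2 = real CARD('n)"
proof -
  have "(mat 1 :: complex^'n^'n) = rdiag (\<lambda>_. 1)" by (simp add: vec_eq_iff mat_def rdiag_def)
  then show ?thesis by (simp add: norm_rdiag_sq)
qed

lemma norm_hermitian_mult_sq:
  assumes "hermitian D"
  shows "(norm (D ** C))\<^sup>2 = (\<Sum>b\<in>UNIV. Re (cip (column b C) (mat_square D *v column b C)))"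
proof -
  have "Re (cip w (mat_square D *v w)) = (norm (D *v w))\<^sup>2" for w
    using cip_hermitian[OF assms, of w "D *v w"]
    by (simp add: mat_square_def cip_self flip: matrix_vector_mul_assoc del: of_real_power)
      (metis Re_complex_of_real)
  then show ?thesis by (simp add: norm_mult_sq_columns)
qed

lemma quadratic_form_mat_integral:
  assumes "mat_integrable M S"
  shows "integrable M (\<lambda>z. Re (cip c (S z *v c)))"
    and "(\<integral>z. Re (cip c (S z *v c)) \<partial>M) = Re (cip c (mat_integral M S *v c))"
proof -
  have eq: "cip c (B *v c) = (\<Sum>a\<in>UNIV. \<Sum>b\<in>UNIV. B $ a $ b * (cnj (c $ a) * c $ b))" for B
    by (simp add: cip_def matrix_vector_mult_def sum_distrib_left algebra_simps)
  have int: "integrable M (\<lambda>z. S z $ a $ b * (cnj (c $ a) * c $ b))" for a b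
    using assms by (simp add: mat_integrable_def)
  then have int2: "integrable M (\<lambda>z. cip c (S z *v c))"
    unfolding eq by (intro Bochner_Integration.integrable_sum)
  then show "integrable M (\<lambda>z. Re (cip c (S z *v c)))" by simp
  have "(\<integral>z. cip c (S z *v c) \<partial>M) = cip c (mat_integral M S *v c)"
    unfolding eq
    by (simp add: Bochner_Integration.integral_sum int mat_integral_def)
  then show "(\<integral>z. Re (cip c (S z *v c)) \<partial>M) = Re (cip c (mat_integral M S *v c))"
    using integral_Re[OF int2] by simp
qed

lemma quadratic_form_sum:
  "finite I \<Longrightarrow> cip c ((\<Sum>i\<in>I. S i) *v c) = (\<Sum>i\<in>I. cip c (S i *v c))"
  by (induction I rule: finite_induct)
    (simp_all add: cip_add_right matrix_vector_mult_add_rdistrib, simp add: cip_def)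

text \<open>The place where the operator-norm hypothesis is converted. The squared norm of
  \<open>D ** C\<close> is the sum of the quadratic forms of the square of \<open>D\<close> at the
  columns of \<open>C\<close>; these forms commute with sums and entrywise integrals, and
  Cauchy-Schwarz bounds each by \<open>v\<close> times the squared norm of the column.\<close>

lemma sum_integral_norm_mult_sq_le:
  assumes "finite I" and herm: "\<And>i z. i \<in> I \<Longrightarrow> z \<in> space (\<mu> i) \<Longrightarrow> hermitian (D i z)"
    and int: "\<And>i. i \<in> I \<Longrightarrow> mat_integrable (\<mu> i) (\<lambda>z. mat_square (D i z))"
    and v: "op_norm (\<Sum>i\<in>I. mat_integral (\<mu> i) (\<lambda>z. mat_square (D i z))) \<le> v"
  shows "i \<in> I \<Longrightarrow> integrable (\<mu> i) (\<lambda>z. (norm (D i z ** C))\<^sup>2)"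
    and "(\<Sum>i\<in>I. \<integral>z. (norm (D i z ** C))\<^sup>2 \<partial>\<mu> i) \<le> v * (norm C)\<^sup>2"
proof -
  define q where "q b i z = Re (cip (column b C) (mat_square (D i z) *v column b C))" for b i z
  have eq: "(norm (D i z ** C))\<^sup>2 = (\<Sum>b\<in>UNIV. q b i z)" if "i \<in> I" "z \<in> space (\<mu> i)" for i z
    using norm_hermitian_mult_sq[OF herm[OF that]] by (simp add: q_def)
  have q: "integrable (\<mu> i) (q b i)" if "i \<in> I" for b i
    unfolding q_def by (rule quadratic_form_mat_integral(1)[OF int[OF that]])
  show "integrable (\<mu> i) (\<lambda>z. (norm (D i z ** C))\<^sup>2)" if "i \<in> I"
    using q that
    by (subst Bochner_Integration.integrable_cong[OF refl eq[OF that]]) auto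
  let ?S = "\<Sum>i\<in>I. mat_integral (\<mu> i) (\<lambda>z. mat_square (D i z))"
  have "(\<Sum>i\<in>I. \<integral>z. (norm (D i z ** C))\<^sup>2 \<partial>\<mu> i) = (\<Sum>i\<in>I. \<integral>z. (\<Sum>b\<in>UNIV. q b i z) \<partial>\<mu> i)"
    by (intro sum.cong refl Bochner_Integration.integral_cong eq)
  also have "\<dots> = (\<Sum>i\<in>I. \<Sum>b\<in>UNIV. \<integral>z. q b i z \<partial>\<mu> i)"
    by (intro sum.cong refl Bochner_Integration.integral_sum q)
  also have "\<dots> = (\<Sum>b\<in>UNIV. \<Sum>i\<in>I. \<integral>z. q b i z \<partial>\<mu> i)"
    by (rule sum.swap)
  also have "\<dots> = (\<Sum>b\<in>UNIV. Re (cip (column b C) (?S *v column b C)))"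
    by (simp add: quadratic_form_sum[OF assms(1)] q_def quadratic_form_mat_integral(2)[OF int])
  also have "\<dots> \<le> (\<Sum>b\<in>UNIV. v * (norm (column b C))\<^sup>2)"
  proof (intro sum_mono)
    fix b
    let ?c = "column b C"
    have "Re (cip ?c (?S *v ?c)) \<le> norm ?c * norm (?S *v ?c)" by (rule Re_cip_le)
    also have "\<dots> \<le> norm ?c * (v * norm ?c)"
      by (intro mult_left_mono order_trans[OF op_norm_bound] mult_right_mono v) auto
    finally show "Re (cip ?c (?S *v ?c)) \<le> v * (norm ?c)\<^sup>2"
      by (simp add: power2_eq_square algebra_simps)
  qed
  also have "\<dots> = v * (norm C)\<^sup>2" by (simp add: norm_sq_columns[of C] sum_distrib_left)
  finally show "(\<Sum>i\<in>I. \<integral>z. (norm (D i z ** C))\<^sup>2 \<partial>\<mu> i) \<le> v * (norm C)\<^sup>2" .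
qed

text \<open>Links the entrywise integrals of the statement with the vector-valued integral used in
  the Efron-Stein part.\<close>

lemma mat_integral_eq:
  assumes "integrable M f"
  shows "mat_integrable M f" "mat_integral M f = (\<integral>x. f x \<partial>M)"
proof -
  show "mat_integrable M f" unfolding mat_integrable_def
    by (intro allI integrable_bounded_linear[OF bounded_linear_compose[OF bounded_linear_vec_nth bounded_linear_vec_nth] assms])
  show "mat_integral M f = (\<integral>x. f x \<partial>M)"
    unfolding mat_integral_def vec_eq_iff
    by (simp add: integral_bounded_linear[OF bounded_linear_compose[OF bounded_linear_vec_nth bounded_linear_vec_nth] assms])
qed

lemma bdd_measurable_mfun:
  fixes G :: "_ \<Rightarrow> complex^'n^'n"
  assumes G: "bdd_measurable N G" and herm: "\<And>p. p \<in> space N \<Longrightarrow> hermitian (G p)"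
    and g': "\<And>r. (g has_real_derivative g' r) (at r)" "continuous_on UNIV g'"
  shows "bdd_measurable N (\<lambda>p. mfun g (G p))"
proof -
  obtain R where R: "\<And>p. p \<in> space N \<Longrightarrow> norm (G p) \<le> R" using G by (auto simp: bdd_measurable_def)
  let ?K = "{A :: complex^'n^'n. hermitian A \<and> norm A \<le> R}"
  have "compact ?K"
    using hermitian_bounded_closed[of R] by (auto simp: compact_eq_bounded_closed intro: boundedI)
  then have "bounded (mfun g ` ?K)"
    by (intro compact_imp_bounded compact_continuous_image continuous_on_mfun[OF g'])
  then obtain B where "\<And>A :: complex^'n^'n. hermitian A \<Longrightarrow> norm A \<le> R \<Longrightarrow> norm (mfun g A) \<le> B"
    by (auto simp: bounded_iff)
  then show ?thesis
    using R herm by (intro bdd_measurableI[where B = B] borel_measurable_mfun[OF bdd_measurableD[OF G] herm R g']) auto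
qed

lemma bdd_measurable_norm_mult_sq:
  assumes "bdd_measurable N D" "bdd_measurable N C"
  shows "bdd_measurable N (\<lambda>p. (norm ((D p :: complex^'n^'n) ** (C p :: complex^'n^'n)))\<^sup>2)"
proof -
  obtain B1 B2 where B: "\<And>p. p \<in> space N \<Longrightarrow> norm (D p) \<le> B1" "\<And>p. p \<in> space N \<Longrightarrow> norm (C p) \<le> B2"
    using assms by (auto simp: bdd_measurable_def)
  have le: "norm (A ** A') \<le> norm A * norm A'" for A A' :: "complex^'n^'n"
  proof -
    have "(norm (A ** A'))\<^sup>2 \<le> (\<Sum>b\<in>UNIV. (norm A * norm (column b A'))\<^sup>2)"
      unfolding norm_mult_sq_columns by (intro sum_mono power_mono norm_matrix_vector_le) auto
    also have "\<dots> = (norm A * norm A')\<^sup>2"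
      by (simp add: power_mult_distrib norm_sq_columns[of A'] sum_distrib_left)
    finally show ?thesis by (rule power2_le_imp_le) simp
  qed
  have cont: "continuous_on UNIV (\<lambda>q :: (complex^'n^'n) \<times> (complex^'n^'n). fst q ** snd q)"
    unfolding matrix_matrix_mult_def by (intro continuous_intros)
  have "(\<lambda>p. D p ** C p) \<in> borel_measurable N"
    using measurable_compose[OF borel_measurable_Pair[OF bdd_measurableD[OF assms(1)] bdd_measurableD[OF assms(2)]]
        borel_measurable_continuous_onI[OF cont]] by simp
  moreover have "norm (D p ** C p) \<le> B1 * B2" if "p \<in> space N" for p
    using order_trans[OF le mult_mono[OF B(1)[OF that] B(2)[OF that]]] B(1)[OF that]
      norm_ge_zero[of "D p"] by simp
  ultimately show ?thesis by (intro bdd_measurable_norm_sq bdd_measurableI)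
qed

text \<open>The hypothesis on \<open>v\<close> in the tested form that the argument uses. The test
  matrix \<open>mat 1\<close> gives oscillation and variance bounds; the matrix k cosh(k G) gives
  the exponential moment. \<open>integrable_sq\<close> is listed separately because a non-integrable
  function has integral 0, so that \<open>fluctuation_le\<close> would say nothing about it before
  \<open>f\<close> is known to be bounded.\<close>

locale coordinate_fluctuation =
  fixes I :: "'i set" and \<mu> :: "'i \<Rightarrow> 'a measure" and f :: "('i \<Rightarrow> 'a) \<Rightarrow> complex^'n^'n" and v :: real
  assumes prob: "\<And>i. prob_space (\<mu> i)" and fin: "finite I"
    and meas: "f \<in> borel_measurable (PiM I \<mu>)"
    and herm: "\<And>x. x \<in> space (PiM I \<mu>) \<Longrightarrow> hermitian (f x)"
    and v_nonneg: "0 \<le> v"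
    and integrable_sq: "\<And>x i. x \<in> space (PiM I \<mu>) \<Longrightarrow> i \<in> I \<Longrightarrow>
        integrable (\<mu> i) (\<lambda>z. (norm (f x - f (x(i := z))))\<^sup>2)"
    and fluctuation_le: "\<And>x (C :: complex^'n^'n). x \<in> space (PiM I \<mu>) \<Longrightarrow>
        (\<Sum>i\<in>I. \<integral>z. (norm ((f x - f (x(i := z))) ** C))\<^sup>2 \<partial>\<mu> i) \<le> v * (norm C)\<^sup>2"
begin

section \<open>Boundedness and variance of \<open>f\<close>\<close>

abbreviation "P \<equiv> PiM I \<mu>"

lemma prob_P: "prob_space P"
  by (intro prob_space_PiM prob)

lemma upd_in_space: "x \<in> space P \<Longrightarrow> i \<in> I \<Longrightarrow> z \<in> space (\<mu> i) \<Longrightarrow> x(i := z) \<in> space P"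
  by (auto simp: space_PiM PiE_iff extensional_def)

lemma integral_sq_le:
  assumes "x \<in> space P" "i \<in> I"
  shows "(\<integral>z. (norm (f x - f (x(i := z))))\<^sup>2 \<partial>\<mu> i) \<le> v * real CARD('n)"
proof -
  have "(\<integral>z. (norm (f x - f (x(i := z))))\<^sup>2 \<partial>\<mu> i) \<le> (\<Sum>i\<in>I. \<integral>z. (norm (f x - f (x(i := z))))\<^sup>2 \<partial>\<mu> i)"
    by (rule member_le_sum[of _ _ "\<lambda>i. \<integral>z. (norm (f x - f (x(i := z))))\<^sup>2 \<partial>\<mu> i"]) (use assms fin in auto)
  also have "\<dots> \<le> v * real CARD('n)"
    using fluctuation_le[OF assms(1), of "mat 1"] by (simp add: norm_mat1_sq del: fun_upd_apply)
  finally show ?thesis .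
qed

text \<open>An averaged bound becomes a pointwise one because it holds at every point, in particular
  at both \<open>x\<close> and \<open>x(i := a)\<close>. Resampling coordinate \<open>i\<close>
  leads from either of them to the same \<open>x(i := z)\<close>, so the triangle inequality through
  it can be integrated over \<open>z\<close>, with \<open>r \<le> 1 + r\<^sup>2\<close> replacing
  norms by squares.\<close>

lemma oscillation_le:
  assumes x: "x \<in> space P" and i: "i \<in> I" and a: "a \<in> space (\<mu> i)"
  shows "norm (f x - f (x(i := a))) \<le> 2 + 2 * (v * real CARD('n))"
proof -
  interpret prob_space "\<mu> i" by (rule prob)
  have y: "x(i := a) \<in> space P" by (rule upd_in_space[OF x i a])
  let ?h = "\<lambda>y z. (norm (f y - f (x(i := z))))\<^sup>2"
  have int: "integrable (\<mu> i) (?h x)" "integrable (\<mu> i) (?h (x(i := a)))"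
    using integrable_sq[OF x i] integrable_sq[OF y i] by (simp_all del: fun_upd_apply)
  have "norm (f x - f (x(i := a))) \<le> 2 + ?h x z + ?h (x(i := a)) z" for z
  proof -
    have r: "r \<le> 1 + r\<^sup>2" for r :: real
      using zero_le_power2[of "r - 1/2"] by (simp add: power2_eq_square algebra_simps)
    have "norm (f x - f (x(i := a))) \<le> norm (f x - f (x(i := z))) + norm (f (x(i := a)) - f (x(i := z)))"
      using norm_triangle_ineq4[of "f x - f (x(i := z))" "f (x(i := a)) - f (x(i := z))"] by (simp del: fun_upd_apply)
    then show ?thesis
      using r[of "norm (f x - f (x(i := z)))"] r[of "norm (f (x(i := a)) - f (x(i := z)))"] by linarith
  qed
  then have "(\<integral>z. norm (f x - f (x(i := a))) \<partial>\<mu> i) \<le> (\<integral>z. 2 + ?h x z + ?h (x(i := a)) z \<partial>\<mu> i)"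
    using int by (intro integral_mono) (auto simp del: fun_upd_apply)
  also have "\<dots> = 2 + (\<integral>z. ?h x z \<partial>\<mu> i) + (\<integral>z. ?h (x(i := a)) z \<partial>\<mu> i)"
    using int by (simp add: prob_space del: fun_upd_apply)
  also have "\<dots> \<le> 2 + 2 * (v * real CARD('n))"
    using integral_sq_le[OF x i] integral_sq_le[OF y i] by (simp del: fun_upd_apply)
  finally show ?thesis by (simp add: prob_space del: fun_upd_apply)
qed

text \<open>Coordinates of \<open>y\<close> are replaced by those of \<open>x\<close> one at a time.
  With \<open>S = I\<close> this bounds \<open>f\<close> itself.\<close>

lemma oscillation_set_le:
  assumes "finite S" "S \<subseteq> I" "x \<in> space P" "y \<in> space P" "\<And>i. i \<notin> S \<Longrightarrow> x i = y i"
  shows "norm (f x - f y) \<le> real (card S) * (2 + 2 * (v * real CARD('n)))"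
  using assms
proof (induction S arbitrary: y rule: finite_induct)
  case empty
  then have "x = y" by auto
  then show ?case by simp
next
  case (insert j S)
  let ?K = "2 + 2 * (v * real CARD('n))"
  have j: "j \<in> I" and xj: "x j \<in> space (\<mu> j)" using insert.prems by (auto simp: space_PiM)
  let ?y = "y(j := x j)"
  have y: "?y \<in> space P" by (rule upd_in_space[OF insert.prems(3) j xj])
  have "norm (f x - f ?y) \<le> real (card S) * ?K"
    by (rule insert.IH[OF _ _ y]) (use insert.prems in auto)
  moreover have "norm (f y - f ?y) \<le> ?K" by (rule oscillation_le[OF insert.prems(3) j xj])
  ultimately have "norm (f x - f y) \<le> real (card S) * ?K + ?K"
    using norm_triangle_ineq4[of "f x - f ?y" "f y - f ?y"] by (simp del: fun_upd_apply)
  then show ?case using insert.hyps by (simp add: algebra_simps)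
qed

lemma bdd_measurable_f: "bdd_measurable P f"
proof -
  interpret prob_space P by (rule prob_P)
  obtain y where y: "y \<in> space P" using not_empty by blast
  show ?thesis
  proof (rule bdd_measurableI[OF meas])
    fix x assume x: "x \<in> space P"
    have "norm (f x - f y) \<le> real (card I) * (2 + 2 * (v * real CARD('n)))"
      using x y by (intro oscillation_set_le fin) (auto simp: space_PiM PiE_iff extensional_def)
    then show "norm (f x) \<le> real (card I) * (2 + 2 * (v * real CARD('n))) + norm (f y)"
      using norm_triangle_sub[of "f x" "f y"] by linarith
  qed
qed

lemma var_f_le: "var P f \<le> v * real CARD('n) / 2"
proof -
  interpret prob_space P by (rule prob_P)
  have b: "bdd_measurable P (\<lambda>x. \<integral>z. (norm (f x - f (x(i := z))))\<^sup>2 \<partial>\<mu> i)" if "i \<in> I" for i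
    using bdd_measurable_integral[OF prob bdd_measurable_sq_diff_upd[OF that bdd_measurable_f]] by (simp del: fun_upd_apply)
  have "var P f \<le> (\<Sum>i\<in>I. \<integral>x. \<integral>z. (norm (f x - f (x(i := z))))\<^sup>2 \<partial>\<mu> i \<partial>P) / 2"
    by (rule efron_stein[OF prob fin bdd_measurable_f])
  also have "(\<Sum>i\<in>I. \<integral>x. \<integral>z. (norm (f x - f (x(i := z))))\<^sup>2 \<partial>\<mu> i \<partial>P)
      = (\<integral>x. (\<Sum>i\<in>I. \<integral>z. (norm (f x - f (x(i := z))))\<^sup>2 \<partial>\<mu> i) \<partial>P)"
    by (intro Bochner_Integration.integral_sum[symmetric] bdd_measurable_integrable[OF prob_P] b)
  also have "\<dots> \<le> (\<integral>x. v * real CARD('n) \<partial>P)"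
  proof (rule integral_mono)
    show "integrable P (\<lambda>x. (\<Sum>i\<in>I. \<integral>z. (norm (f x - f (x(i := z))))\<^sup>2 \<partial>\<mu> i))"
      by (intro Bochner_Integration.integrable_sum bdd_measurable_integrable[OF prob_P] b)
    show "(\<Sum>i\<in>I. \<integral>z. (norm (f x - f (x(i := z))))\<^sup>2 \<partial>\<mu> i) \<le> v * real CARD('n)"
      if "x \<in> space P" for x
      using fluctuation_le[OF that, of "mat 1"] by (simp add: norm_mat1_sq del: fun_upd_apply)
  qed simp
  finally show ?thesis by (simp add: prob_space)
qed

section \<open>Symmetrization and the exponential moment\<close>

definition pair_diff :: "('i \<Rightarrow> 'a) \<times> ('i \<Rightarrow> 'a) \<Rightarrow> complex^'n^'n" where
  "pair_diff p = f (fst p) - f (snd p)"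

lemma bdd_measurable_pair_diff: "bdd_measurable (P \<Otimes>\<^sub>M P) pair_diff"
  unfolding pair_diff_def by (intro bdd_measurable_diff bdd_measurable_compose[OF bdd_measurable_f] measurable_fst measurable_snd)

lemma hermitian_pair_diff: "x \<in> space P \<Longrightarrow> y \<in> space P \<Longrightarrow> hermitian (pair_diff (x, y))"
  by (simp add: pair_diff_def hermitian_diff herm)

lemma bdd_measurable_mfun_pair_diff:
  assumes "\<And>r. (g has_real_derivative g' r) (at r)" "continuous_on UNIV g'"
  shows "bdd_measurable (P \<Otimes>\<^sub>M P) (\<lambda>p. mfun g (pair_diff p))"
  by (rule bdd_measurable_mfun[OF bdd_measurable_pair_diff _ assms]) (auto simp: space_pair_measure hermitian_pair_diff)

lemma pair_diff_swap: "pair_diff (y, x) = - pair_diff (x, y)"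
  by (simp add: pair_diff_def)

lemma bdd_measurable_sinh_pair_diff: "bdd_measurable (P \<Otimes>\<^sub>M P) (\<lambda>p. mfun (\<lambda>r. sinh (k * r)) (pair_diff p))"
  by (rule bdd_measurable_mfun_pair_diff[where g' = "\<lambda>r. k * cosh (k * r)"])
    (auto intro!: derivative_eq_intros continuous_intros)

lemma bdd_measurable_cosh_pair_diff: "bdd_measurable (P \<Otimes>\<^sub>M P) (\<lambda>p. mfun (\<lambda>r. k * cosh (k * r)) (pair_diff p))"
  by (rule bdd_measurable_mfun_pair_diff[where g' = "\<lambda>r. k * (k * sinh (k * r))"])
    (auto intro!: derivative_eq_intros continuous_intros)

lemma bdd_measurable_exp_pair_diff: "bdd_measurable (P \<Otimes>\<^sub>M P) (\<lambda>p. mfun (\<lambda>r. exp (k * r)) (pair_diff p))"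
  by (rule bdd_measurable_mfun_pair_diff[where g' = "\<lambda>r. k * exp (k * r)"])
    (auto intro!: derivative_eq_intros continuous_intros)

text \<open>With \<open>y\<close> frozen, an increment of \<open>pair_diff\<close> in
  \<open>x\<close> is an increment of \<open>f\<close>, so the fluctuation hypothesis on
  \<open>f\<close> applies unchanged to every slice.\<close>

lemma var_sinh_pair_diff_le:
  assumes y: "y \<in> space P"
  shows "var P (\<lambda>x. mfun (\<lambda>r. sinh (k * r)) (pair_diff (x, y)))
    \<le> v * k\<^sup>2 / 2 * (real CARD('n) + (\<integral>x. (norm (mfun (\<lambda>r. sinh (k * r)) (pair_diff (x, y))))\<^sup>2 \<partial>P))"
proof -
  interpret prob_space P by (rule prob_P)
  define H where "H = (\<lambda>x. mfun (\<lambda>r. sinh (k * r)) (pair_diff (x, y)))"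
  define C where "C = (\<lambda>x. mfun (\<lambda>r. k * cosh (k * r)) (pair_diff (x, y)))"
  define \<Phi> where "\<Phi> = (\<lambda>p. (norm ((f (fst p) - f (snd p)) ** C (fst p)))\<^sup>2)"
  have H: "bdd_measurable P H" unfolding H_def by (rule bdd_measurable_Pair2[OF bdd_measurable_sinh_pair_diff y])
  have C: "bdd_measurable P C" unfolding C_def by (rule bdd_measurable_Pair2[OF bdd_measurable_cosh_pair_diff y])
  have \<Phi>: "bdd_measurable (P \<Otimes>\<^sub>M P) \<Phi>"
    unfolding \<Phi>_def
    by (intro bdd_measurable_norm_mult_sq bdd_measurable_diff bdd_measurable_compose[OF bdd_measurable_f] bdd_measurable_compose[OF C] measurable_fst measurable_snd)
  have b1: "bdd_measurable (P \<Otimes>\<^sub>M \<mu> i) (\<lambda>p. \<Phi> (fst p, (fst p)(i := snd p)))"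
    and b2: "bdd_measurable (P \<Otimes>\<^sub>M \<mu> i) (\<lambda>p. \<Phi> ((fst p)(i := snd p), fst p))" if "i \<in> I" for i
    by (intro bdd_measurable_compose[OF \<Phi>] measurable_Pair measurable_fst measurable_upd that)+
  have b3: "bdd_measurable P (\<lambda>x. \<integral>z. \<Phi> (x, x(i := z)) \<partial>\<mu> i)" "bdd_measurable P (\<lambda>x. \<integral>z. \<Phi> (x(i := z), x) \<partial>\<mu> i)" if "i \<in> I" for i
    using bdd_measurable_integral[OF prob b1[OF that]] bdd_measurable_integral[OF prob b2[OF that]] by (simp_all del: fun_upd_apply)
  have g: "(sinh (k * r) - sinh (k * s))\<^sup>2 \<le> (r - s)\<^sup>2 * (((k * cosh (k * r))\<^sup>2 + (k * cosh (k * s))\<^sup>2) / 2)" for r s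
  proof -
    have "(k * r - k * s)\<^sup>2 = k\<^sup>2 * (r - s)\<^sup>2"
      by (simp add: power_mult_distrib flip: right_diff_distrib)
    then show ?thesis
      using sinh_diff_sq_le[of "k * r" "k * s"]
      by (simp only: power_mult_distrib) (simp add: algebra_simps)
  qed
  \<comment> \<open>In \<open>\<Phi> (x, x')\<close> the hyperbolic factor is taken at the first
    argument. Of the two terms only \<open>\<Phi> (x, x(i := z))\<close> has a factor independent of
    \<open>z\<close>, as \<open>fluctuation_le\<close> requires; the other has the same integral by
    exchanging coordinate \<open>i\<close>.\<close>
  have H_le: "(norm (H x - H x'))\<^sup>2 \<le> (\<Phi> (x, x') + \<Phi> (x', x)) / 2" if "x \<in> space P" "x' \<in> space P" for x x'
  proof -
    have "pair_diff (x, y) - pair_diff (x', y) = f x - f x'" by (simp add: pair_diff_def)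
    moreover have "(f x - f x') ** C x' = - ((f x' - f x) ** C x')"
      by (simp add: matrix_diff_left)
    then have "norm ((f x - f x') ** C x') = norm ((f x' - f x) ** C x')"
      by (simp only: norm_minus_cancel)
    ultimately show ?thesis
      using norm_mfun_diff_le[OF hermitian_pair_diff[OF that(1) y] hermitian_pair_diff[OF that(2) y] g]
      by (simp add: H_def C_def \<Phi>_def)
  qed
  have "var P H \<le> (\<Sum>i\<in>I. \<integral>x. \<integral>z. (norm (H x - H (x(i := z))))\<^sup>2 \<partial>\<mu> i \<partial>P) / 2"
    by (rule efron_stein[OF prob fin H])
  also have "(\<Sum>i\<in>I. \<integral>x. \<integral>z. (norm (H x - H (x(i := z))))\<^sup>2 \<partial>\<mu> i \<partial>P) \<le> (\<Sum>i\<in>I. \<integral>x. \<integral>z. \<Phi> (x, x(i := z)) \<partial>\<mu> i \<partial>P)"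
  proof (rule sum_mono)
    fix i assume i: "i \<in> I"
    have bH: "bdd_measurable (P \<Otimes>\<^sub>M \<mu> i) (\<lambda>p. (norm (H (fst p) - H ((fst p)(i := snd p))))\<^sup>2)"
      by (rule bdd_measurable_sq_diff_upd[OF i H])
    have "(\<integral>x. \<integral>z. (norm (H x - H (x(i := z))))\<^sup>2 \<partial>\<mu> i \<partial>P)
        \<le> (\<integral>x. ((\<integral>z. \<Phi> (x, x(i := z)) \<partial>\<mu> i) + (\<integral>z. \<Phi> (x(i := z), x) \<partial>\<mu> i)) / 2 \<partial>P)"
    proof (rule integral_mono)
      show "integrable P (\<lambda>x. \<integral>z. (norm (H x - H (x(i := z))))\<^sup>2 \<partial>\<mu> i)"
        using bdd_measurable_integrable[OF prob_P bdd_measurable_integral[OF prob bH]] by (simp del: fun_upd_apply)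
      show "integrable P (\<lambda>x. ((\<integral>z. \<Phi> (x, x(i := z)) \<partial>\<mu> i) + (\<integral>z. \<Phi> (x(i := z), x) \<partial>\<mu> i)) / 2)"
        by (intro integrable_divide Bochner_Integration.integrable_add bdd_measurable_integrable[OF prob_P] b3 i)
      fix x assume x: "x \<in> space P"
      have int: "integrable (\<mu> i) (\<lambda>z. \<Phi> (x, x(i := z)))" "integrable (\<mu> i) (\<lambda>z. \<Phi> (x(i := z), x))"
        using bdd_measurable_integrable[OF prob bdd_measurable_Pair1[OF b1[OF i] x]] bdd_measurable_integrable[OF prob bdd_measurable_Pair1[OF b2[OF i] x]]
        by (simp_all del: fun_upd_apply)
      have "(\<integral>z. (norm (H x - H (x(i := z))))\<^sup>2 \<partial>\<mu> i) \<le> (\<integral>z. (\<Phi> (x, x(i := z)) + \<Phi> (x(i := z), x)) / 2 \<partial>\<mu> i)"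
      proof (rule integral_mono)
        show "integrable (\<mu> i) (\<lambda>z. (norm (H x - H (x(i := z))))\<^sup>2)"
          using bdd_measurable_integrable[OF prob bdd_measurable_Pair1[OF bH x]] by (simp del: fun_upd_apply)
        show "integrable (\<mu> i) (\<lambda>z. (\<Phi> (x, x(i := z)) + \<Phi> (x(i := z), x)) / 2)"
          by (intro integrable_divide Bochner_Integration.integrable_add int)
      qed (intro H_le x upd_in_space i)
      also have "\<dots> = ((\<integral>z. \<Phi> (x, x(i := z)) \<partial>\<mu> i) + (\<integral>z. \<Phi> (x(i := z), x) \<partial>\<mu> i)) / 2"
        using int by (simp del: fun_upd_apply)
      finally show "(\<integral>z. (norm (H x - H (x(i := z))))\<^sup>2 \<partial>\<mu> i)
        \<le> ((\<integral>z. \<Phi> (x, x(i := z)) \<partial>\<mu> i) + (\<integral>z. \<Phi> (x(i := z), x) \<partial>\<mu> i)) / 2" .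
    qed
    also have "\<dots> = ((\<integral>x. \<integral>z. \<Phi> (x, x(i := z)) \<partial>\<mu> i \<partial>P) + (\<integral>x. \<integral>z. \<Phi> (x(i := z), x) \<partial>\<mu> i \<partial>P)) / 2"
      using bdd_measurable_integrable[OF prob_P b3(1)[OF i]] bdd_measurable_integrable[OF prob_P b3(2)[OF i]] by (simp del: fun_upd_apply)
    also have "\<dots> = (\<integral>x. \<integral>z. \<Phi> (x, x(i := z)) \<partial>\<mu> i \<partial>P)"
      using integral_exchange_coordinate[OF prob fin i \<Phi>] by (simp del: fun_upd_apply)
    finally show "(\<integral>x. \<integral>z. (norm (H x - H (x(i := z))))\<^sup>2 \<partial>\<mu> i \<partial>P) \<le> (\<integral>x. \<integral>z. \<Phi> (x, x(i := z)) \<partial>\<mu> i \<partial>P)" .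
  qed
  also have "(\<Sum>i\<in>I. \<integral>x. \<integral>z. \<Phi> (x, x(i := z)) \<partial>\<mu> i \<partial>P) = (\<integral>x. (\<Sum>i\<in>I. \<integral>z. \<Phi> (x, x(i := z)) \<partial>\<mu> i) \<partial>P)"
    by (intro Bochner_Integration.integral_sum[symmetric] bdd_measurable_integrable[OF prob_P] b3)
  also have "\<dots> \<le> (\<integral>x. v * (norm (C x))\<^sup>2 \<partial>P)"
  proof (rule integral_mono)
    show "integrable P (\<lambda>x. (\<Sum>i\<in>I. \<integral>z. \<Phi> (x, x(i := z)) \<partial>\<mu> i))"
      by (intro Bochner_Integration.integrable_sum bdd_measurable_integrable[OF prob_P] b3)
    show "integrable P (\<lambda>x. v * (norm (C x))\<^sup>2)"
      by (intro bdd_measurable_integrable[OF prob_P] bdd_measurable_mult_left bdd_measurable_norm_sq C)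
    show "(\<Sum>i\<in>I. \<integral>z. \<Phi> (x, x(i := z)) \<partial>\<mu> i) \<le> v * (norm (C x))\<^sup>2" if "x \<in> space P" for x
      using fluctuation_le[OF that, of "C x"] by (simp add: \<Phi>_def del: fun_upd_apply)
  qed
  also have "\<dots> = (\<integral>x. v * (k\<^sup>2 * (real CARD('n) + (norm (H x))\<^sup>2)) \<partial>P)"
    by (rule Bochner_Integration.integral_cong[OF refl])
      (simp add: C_def H_def norm_mfun_exp_cosh_sinh(2)[OF hermitian_pair_diff[OF _ y]])
  also have "\<dots> = v * (k\<^sup>2 * (real CARD('n) + (\<integral>x. (norm (H x))\<^sup>2 \<partial>P)))"
    using bdd_measurable_integrable[OF prob_P bdd_measurable_norm_sq[OF H]] by (simp add: prob_space)
  finally show ?thesis by (simp add: H_def)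
qed

text \<open>The \<open>x\<close> and the \<open>y\<close> directions contribute equally, each at
  most half of v k^2 (d + E |H|^2). The second moment thus bounds itself, and as a real number it
  can be moved to the left side.\<close>

lemma integral_sinh_pair_diff_le:
  "(1 - v * k\<^sup>2) * (\<integral>x. \<integral>y. (norm (mfun (\<lambda>r. sinh (k * r)) (pair_diff (x, y))))\<^sup>2 \<partial>P \<partial>P) \<le> v * k\<^sup>2 * real CARD('n)"
proof -
  interpret prob_space P by (rule prob_P)
  define H where "H = (\<lambda>p. mfun (\<lambda>r. sinh (k * r)) (pair_diff p))"
  have H: "bdd_measurable (P \<Otimes>\<^sub>M P) H" unfolding H_def by (rule bdd_measurable_sinh_pair_diff)
  have H2: "bdd_measurable (P \<Otimes>\<^sub>M P) (\<lambda>p. (norm (H p))\<^sup>2)" by (rule bdd_measurable_norm_sq[OF H])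
  have swap: "H (y, x) = - H (x, y)" if "x \<in> space P" "y \<in> space P" for x y
    unfolding H_def pair_diff_swap[of y x] by (rule mfun_odd[OF hermitian_pair_diff[OF that]]) simp
  define E where "E = (\<integral>x. \<integral>y. (norm (H (x, y)))\<^sup>2 \<partial>P \<partial>P)"
  have E: "E = (\<integral>y. \<integral>x. (norm (H (x, y)))\<^sup>2 \<partial>P \<partial>P)"
    unfolding E_def by (rule bdd_measurable_fubini[OF prob_P prob_P H2])
  \<comment> \<open>Swapping the integration variables changes the sign of \<open>H\<close> but not
    the value of the integral, so the mean is 0 and the second moment is the full variance.\<close>
  have "(\<integral>x. \<integral>y. H (x, y) \<partial>P \<partial>P) = (\<integral>x. \<integral>y. H (y, x) \<partial>P \<partial>P)"
    by (rule bdd_measurable_fubini[OF prob_P prob_P H])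
  also have "\<dots> = (\<integral>x. \<integral>y. - H (x, y) \<partial>P \<partial>P)"
    by (intro Bochner_Integration.integral_cong refl swap)
  also have "\<dots> = - (\<integral>x. \<integral>y. H (x, y) \<partial>P \<partial>P)" by simp
  finally have zero: "(\<integral>x. \<integral>y. H (x, y) \<partial>P \<partial>P) = 0" by (simp add: eq_neg_iff_add_eq_0 flip: scaleR_2)
  have var_swap: "var P (\<lambda>y. H (x, y)) = var P (\<lambda>y. H (y, x))" if "x \<in> space P" for x
  proof -
    have "(\<integral>y. H (x, y) \<partial>P) = (\<integral>y. - H (y, x) \<partial>P)"
      and "(\<integral>y. (norm (H (x, y)))\<^sup>2 \<partial>P) = (\<integral>y. (norm (H (y, x)))\<^sup>2 \<partial>P)"
      by (rule Bochner_Integration.integral_cong[OF refl], simp add: swap[OF _ that])+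
    then show ?thesis by (simp add: var_def)
  qed
  have vb: "bdd_measurable P (\<lambda>y. var P (\<lambda>x. H (x, y)))"
    unfolding var_def by (intro bdd_measurable_diff bdd_measurable_norm_sq bdd_measurable_integral2[OF prob_P] bdd_measurable_integral2[OF prob_P H2] H)
  have "E \<le> (\<integral>y. var P (\<lambda>x. H (x, y)) \<partial>P) + (\<integral>x. var P (\<lambda>y. H (x, y)) \<partial>P)"
    using var_pair_le[OF prob_P prob_P H] by (simp add: zero E_def)
  also have "(\<integral>x. var P (\<lambda>y. H (x, y)) \<partial>P) = (\<integral>y. var P (\<lambda>x. H (x, y)) \<partial>P)"
    by (intro Bochner_Integration.integral_cong refl var_swap)
  also have "(\<integral>y. var P (\<lambda>x. H (x, y)) \<partial>P)
      \<le> (\<integral>y. v * k\<^sup>2 / 2 * (real CARD('n) + (\<integral>x. (norm (H (x, y)))\<^sup>2 \<partial>P)) \<partial>P)"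
  proof (rule integral_mono)
    show "integrable P (\<lambda>y. var P (\<lambda>x. H (x, y)))" by (rule bdd_measurable_integrable[OF prob_P vb])
    show "integrable P (\<lambda>y. v * k\<^sup>2 / 2 * (real CARD('n) + (\<integral>x. (norm (H (x, y)))\<^sup>2 \<partial>P)))"
      by (intro bdd_measurable_integrable[OF prob_P] bdd_measurable_mult_left bdd_measurable_add bdd_measurable_const bdd_measurable_integral2[OF prob_P H2])
    show "var P (\<lambda>x. H (x, y)) \<le> v * k\<^sup>2 / 2 * (real CARD('n) + (\<integral>x. (norm (H (x, y)))\<^sup>2 \<partial>P))"
      if "y \<in> space P" for y
      unfolding H_def by (rule var_sinh_pair_diff_le[OF that])
  qed
  also have "\<dots> = v * k\<^sup>2 / 2 * (real CARD('n) + E)"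
    using bdd_measurable_integrable[OF prob_P bdd_measurable_integral2[OF prob_P H2]] by (simp add: E prob_space)
  finally have "E \<le> v * k\<^sup>2 * (real CARD('n) + E)" by (simp add: mult_ac)
  then show ?thesis by (simp add: E_def H_def algebra_simps)
qed

text \<open>Adding the integrand at (x, y) and (y, x) cancels the odd part of the exponential: the
  mean is d + 2 E |H|^2. With v k^2 = 1/4 the estimate of the sinh moment reads E |H|^2 <= d /
  3.\<close>

lemma integral_exp_pair_diff_le:
  assumes "v * k\<^sup>2 = 1 / 4"
  shows "(\<integral>x. \<integral>y. (norm (mfun (\<lambda>r. exp (k * r)) (pair_diff (x, y))))\<^sup>2 \<partial>P \<partial>P) \<le> 5 / 3 * real CARD('n)"
proof -
  interpret prob_space P by (rule prob_P)
  define T where "T = (\<lambda>p. (norm (mfun (\<lambda>r. exp (k * r)) (pair_diff p)))\<^sup>2)"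
  define S where "S = (\<lambda>p. (norm (mfun (\<lambda>r. sinh (k * r)) (pair_diff p)))\<^sup>2)"
  have T: "bdd_measurable (P \<Otimes>\<^sub>M P) T" unfolding T_def by (rule bdd_measurable_norm_sq[OF bdd_measurable_exp_pair_diff])
  have S: "bdd_measurable (P \<Otimes>\<^sub>M P) S" unfolding S_def by (rule bdd_measurable_norm_sq[OF bdd_measurable_sinh_pair_diff])
  have TS: "T (x, y) + T (y, x) = 2 * real CARD('n) + 4 * S (x, y)" if "x \<in> space P" "y \<in> space P" for x y
    unfolding T_def S_def pair_diff_swap[of y x] by (rule norm_mfun_exp_cosh_sinh(1)[OF hermitian_pair_diff[OF that]])
  have "2 * (\<integral>x. \<integral>y. T (x, y) \<partial>P \<partial>P) = (\<integral>x. \<integral>y. T (x, y) \<partial>P \<partial>P) + (\<integral>x. \<integral>y. T (y, x) \<partial>P \<partial>P)"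
    using bdd_measurable_fubini[OF prob_P prob_P T] by simp
  also have "\<dots> = (\<integral>x. (\<integral>y. T (x, y) \<partial>P) + (\<integral>y. T (y, x) \<partial>P) \<partial>P)"
    by (intro Bochner_Integration.integral_add[symmetric] bdd_measurable_integrable[OF prob_P] bdd_measurable_integral[OF prob_P T]
        bdd_measurable_integral2[OF prob_P T])
  also have "\<dots> = (\<integral>x. 2 * real CARD('n) + 4 * (\<integral>y. S (x, y) \<partial>P) \<partial>P)"
  proof (rule Bochner_Integration.integral_cong[OF refl])
    fix x assume x: "x \<in> space P"
    have "(\<integral>y. T (x, y) \<partial>P) + (\<integral>y. T (y, x) \<partial>P) = (\<integral>y. T (x, y) + T (y, x) \<partial>P)"
      by (intro Bochner_Integration.integral_add[symmetric] bdd_measurable_integrable[OF prob_P] bdd_measurable_Pair1[OF T x] bdd_measurable_Pair2[OF T x])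
    also have "\<dots> = (\<integral>y. 2 * real CARD('n) + 4 * S (x, y) \<partial>P)"
      by (intro Bochner_Integration.integral_cong refl TS x)
    also have "\<dots> = 2 * real CARD('n) + 4 * (\<integral>y. S (x, y) \<partial>P)"
      using bdd_measurable_integrable[OF prob_P bdd_measurable_Pair1[OF S x]] by (simp add: prob_space)
    finally show "(\<integral>y. T (x, y) \<partial>P) + (\<integral>y. T (y, x) \<partial>P) = 2 * real CARD('n) + 4 * (\<integral>y. S (x, y) \<partial>P)" .
  qed
  also have "\<dots> = 2 * real CARD('n) + 4 * (\<integral>x. \<integral>y. S (x, y) \<partial>P \<partial>P)"
    using bdd_measurable_integrable[OF prob_P bdd_measurable_integral[OF prob_P S]] by (simp add: prob_space)
  finally have "(\<integral>x. \<integral>y. T (x, y) \<partial>P \<partial>P) = real CARD('n) + 2 * (\<integral>x. \<integral>y. S (x, y) \<partial>P \<partial>P)" by simp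
  moreover have "3 * (\<integral>x. \<integral>y. S (x, y) \<partial>P \<partial>P) \<le> real CARD('n)"
    using integral_sinh_pair_diff_le[of k] unfolding assms S_def by simp
  ultimately have "(\<integral>x. \<integral>y. T (x, y) \<partial>P \<partial>P) \<le> 5 / 3 * real CARD('n)" by linarith
  then show ?thesis by (simp add: T_def)
qed

section \<open>Tail bounds for the largest eigenvalue\<close>

definition centered :: "('i \<Rightarrow> 'a) \<Rightarrow> complex^'n^'n" where
  "centered x = f x - mat_integral P f"

lemma integrable_f: "integrable P f"
  by (rule bdd_measurable_integrable[OF prob_P bdd_measurable_f])

lemma centered_eq: "centered x = f x - (\<integral>y. f y \<partial>P)"
  by (simp add: centered_def mat_integral_eq[OF integrable_f])

lemma hermitian_centered:
  assumes "x \<in> space P" shows "hermitian (centered x)"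
proof -
  have "mat_integral P f $ a $ b = cnj (mat_integral P f $ b $ a)" for a b
  proof -
    have "(\<integral>z. f z $ a $ b \<partial>P) = (\<integral>z. cnj (f z $ b $ a) \<partial>P)"
      by (rule Bochner_Integration.integral_cong[OF refl]) (metis herm hermitian_def)
    then show ?thesis by (simp add: mat_integral_def)
  qed
  then have "hermitian (mat_integral P f)" unfolding hermitian_def by blast
  then show ?thesis unfolding centered_def by (rule hermitian_diff[OF herm[OF assms]])
qed

text \<open>No measurability of \<open>A\<close> is assumed: a non-measurable set has \<open>measure\<close> 0.  This avoids
  proving that \<open>lambda_max\<close> is measurable.\<close>

lemma measure_le_of_integral:
  assumes A: "A \<subseteq> space P" and h: "bdd_measurable P h" and le: "\<And>x. x \<in> A \<Longrightarrow> c \<le> h x" and "0 < c" "\<And>x. 0 \<le> h x"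
  shows "measure P A \<le> (\<integral>x. h x \<partial>P) / c"
proof (cases "A \<in> sets P")
  case True
  interpret prob_space P by (rule prob_P)
  have "integrable P (\<lambda>x. c * indicator A x)"
    using True by (simp add: emeasure_eq_measure)
  then have "(\<integral>x. c * indicator A x \<partial>P) \<le> (\<integral>x. h x \<partial>P)"
    using assms by (intro integral_mono bdd_measurable_integrable[OF prob_P h]) (auto simp: indicator_def)
  moreover have "(\<integral>x. c * indicator A x \<partial>P) = c * measure P A"
    using True by simp
  ultimately show ?thesis using \<open>0 < c\<close> by (simp add: field_simps)
next
  case False
  have "0 \<le> (\<integral>x. h x \<partial>P)" using assms(5) by (intro Bochner_Integration.integral_nonneg) auto
  then show ?thesis using False \<open>0 < c\<close> by (simp add: measure_notin_sets)
qed

text \<open>Adding \<open>c\<close> times the identity before squaring makes the second-moment bound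
  one-sided: an eigenvalue of at least \<open>t\<close> becomes one of at least
  \<open>t + c\<close>, which bounds the Frobenius norm from below. Unshifted, Markov's inequality
  would give d v / (2 t^2), which is useless for small \<open>t\<close>.\<close>

lemma cantelli_lambda_max:
  assumes t: "0 < t"
  shows "measure P {x \<in> space P. lambda_max (centered x) \<ge> t} \<le> real CARD('n) * (v / (v + 2 * t\<^sup>2))"
proof -
  interpret prob_space P by (rule prob_P)
  \<comment> \<open>Minimizes (v / 2 + c^2) / (t + c)^2, the bound on the tail per
    dimension.\<close>
  define c where "c = v / (2 * t)"
  have c: "0 \<le> c" using v_nonneg t by (simp add: c_def)
  define m where "m = (\<integral>y. f y \<partial>P)"
  define J :: "complex^'n^'n" where "J = rdiag (\<lambda>_. c)"
  have J: "(norm J)\<^sup>2 = c\<^sup>2 * real CARD('n)" by (simp add: J_def norm_rdiag_sq)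
  define h where "h = (\<lambda>x. (norm (f x - (m - J)))\<^sup>2)"
  have h: "bdd_measurable P h" unfolding h_def by (intro bdd_measurable_norm_sq bdd_measurable_diff bdd_measurable_f bdd_measurable_const)
  have le: "(t + c)\<^sup>2 \<le> h x" if x: "x \<in> space P" "lambda_max (centered x) \<ge> t" for x
  proof -
    obtain u where u: "norm u = 1" "centered x *v u = complex_of_real (lambda_max (centered x)) *s u"
      using lambda_max_eigenvector[OF hermitian_centered[OF x(1)]] by blast
    have "J *v u = complex_of_real c *s u"
      by (simp add: J_def vec_eq_iff rdiag_vector_nth)
    moreover have eq: "f x - (m - J) = centered x + J" by (simp add: centered_eq m_def)
    ultimately have "(f x - (m - J)) *v u = complex_of_real (lambda_max (centered x) + c) *s u"
      unfolding eq by (simp add: matrix_vector_mult_add_rdistrib u(2) vector_sadd_rdistrib)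
    then have "norm ((f x - (m - J)) *v u) = \<bar>lambda_max (centered x) + c\<bar>"
      by (simp add: norm_cvec_smult u(1) del: of_real_add)
    then have "t + c \<le> norm (f x - (m - J))"
      using norm_matrix_vector_le[of "f x - (m - J)" u] u(1) x(2) by simp
    then show ?thesis unfolding h_def using t c by (intro power_mono) auto
  qed
  have "(\<integral>x. h x \<partial>P) = var P f + (norm J)\<^sup>2"
    unfolding h_def integral_norm_sq_diff_const[OF prob_P bdd_measurable_f] var_def m_def[symmetric]
    by (simp add: power2_norm_eq_inner inner_diff_left inner_diff_right inner_commute[of J m])
  also have "\<dots> \<le> real CARD('n) * (v / 2 + c\<^sup>2)"
    using var_f_le J by (simp add: algebra_simps)
  finally have int: "(\<integral>x. h x \<partial>P) \<le> real CARD('n) * (v / 2 + c\<^sup>2)" .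
  have pos: "0 < (t + c)\<^sup>2" using t c by simp
  have "measure P {x \<in> space P. lambda_max (centered x) \<ge> t} \<le> (\<integral>x. h x \<partial>P) / (t + c)\<^sup>2"
    by (rule measure_le_of_integral[OF _ h _ pos]) (use le in \<open>auto simp: h_def\<close>)
  also have "\<dots> \<le> real CARD('n) * (v / 2 + c\<^sup>2) / (t + c)\<^sup>2"
    using int pos by (intro divide_right_mono) auto
  also have "(v / 2 + c\<^sup>2) / (t + c)\<^sup>2 = v / (v + 2 * t\<^sup>2)"
  proof -
    have p: "0 < v + 2 * t\<^sup>2" using v_nonneg t by (intro add_nonneg_pos) auto
    have a: "v / 2 + c\<^sup>2 = v * (v + 2 * t\<^sup>2) / (4 * t\<^sup>2)" and b: "t + c = (v + 2 * t\<^sup>2) / (2 * t)"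
      using t by (simp_all add: c_def power2_eq_square field_simps)
    show ?thesis unfolding a b using p t by (simp add: power_divide) (simp add: power2_eq_square)
  qed
  then have "real CARD('n) * (v / 2 + c\<^sup>2) / (t + c)\<^sup>2 = real CARD('n) * (v / (v + 2 * t\<^sup>2))"
    by (metis times_divide_eq_right)
  finally show ?thesis .
qed

text \<open>\<open>centered x\<close> is the average of \<open>pair_diff (x, y)\<close> over
  \<open>y\<close>. For a unit top eigenvector \<open>u\<close> of it, the quadratic forms of
  \<open>pair_diff (x, y)\<close> at \<open>u\<close> therefore average to \<open>s\<close>. The
  tangent bound at \<open>s\<close> is affine in the form, so integrating it leaves exactly
  \<open>exp (2 * k * s)\<close>.\<close>

lemma exp_lambda_max_le:
  assumes x: "x \<in> space P" and k: "0 \<le> k"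
  shows "exp (2 * k * lambda_max (centered x)) \<le> (\<integral>y. (norm (mfun (\<lambda>r. exp (k * r)) (pair_diff (x, y))))\<^sup>2 \<partial>P)"
proof -
  interpret prob_space P by (rule prob_P)
  define s where "s = lambda_max (centered x)"
  obtain u where u: "norm u = 1" "centered x *v u = complex_of_real s *s u"
    using lambda_max_eigenvector[OF hermitian_centered[OF x]] unfolding s_def by blast
  have pair_diff: "bdd_measurable P (\<lambda>y. pair_diff (x, y))" by (rule bdd_measurable_Pair1[OF bdd_measurable_pair_diff x])
  note iG = bdd_measurable_integrable[OF prob_P pair_diff]
  have mi: "mat_integral P (\<lambda>y. pair_diff (x, y)) = centered x"
    unfolding mat_integral_eq(2)[OF iG] centered_eq using integrable_f by (simp add: pair_diff_def prob_space)
  define q where "q = (\<lambda>y. Re (cip u (pair_diff (x, y) *v u)))"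
  have q: "integrable P q" "(\<integral>y. q y \<partial>P) = s"
    unfolding q_def using quadratic_form_mat_integral[OF mat_integral_eq(1)[OF iG], of u]
    by (simp_all add: mi u cip_smult_right cip_self)
  have "exp (2 * k * s) = (\<integral>y. exp (2 * k * s) * (1 + 2 * k * (q y - s)) \<partial>P)"
    using q by (simp add: prob_space)
  also have "\<dots> \<le> (\<integral>y. (norm (mfun (\<lambda>r. exp (k * r)) (pair_diff (x, y))))\<^sup>2 \<partial>P)"
  proof (rule integral_mono)
    show "integrable P (\<lambda>y. exp (2 * k * s) * (1 + 2 * k * (q y - s)))" using q(1) by simp
    show "integrable P (\<lambda>y. (norm (mfun (\<lambda>r. exp (k * r)) (pair_diff (x, y))))\<^sup>2)"
      by (intro bdd_measurable_integrable[OF prob_P] bdd_measurable_norm_sq bdd_measurable_Pair1[OF bdd_measurable_exp_pair_diff x])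
    show "exp (2 * k * s) * (1 + 2 * k * (q y - s)) \<le> (norm (mfun (\<lambda>r. exp (k * r)) (pair_diff (x, y))))\<^sup>2"
      if "y \<in> space P" for y
      unfolding q_def by (rule exp_tangent_le_norm_mfun[OF hermitian_pair_diff[OF x that] u(1) k])
  qed
  finally show ?thesis by (simp add: s_def)
qed

lemma exponential_tail_lambda_max:
  assumes v: "0 < v"
  shows "measure P {x \<in> space P. lambda_max (centered x) \<ge> t} \<le> 5 / 3 * real CARD('n) * exp (- (t / sqrt v))"
proof -
  \<comment> \<open>Makes the rate \<open>2 * k * t\<close> equal to t / sqrt v, and v k^2 equal to
    1/4.\<close>
  define k where "k = 1 / (2 * sqrt v)"
  have k: "0 < k" "v * k\<^sup>2 = 1 / 4" using v by (simp_all add: k_def power_divide power_mult_distrib)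
  define h where "h = (\<lambda>x. \<integral>y. (norm (mfun (\<lambda>r. exp (k * r)) (pair_diff (x, y))))\<^sup>2 \<partial>P)"
  have h: "bdd_measurable P h" unfolding h_def by (rule bdd_measurable_integral[OF prob_P bdd_measurable_norm_sq[OF bdd_measurable_exp_pair_diff]])
  have "exp (2 * k * t) \<le> h x" if "x \<in> space P" "lambda_max (centered x) \<ge> t" for x
  proof -
    have "exp (2 * k * t) \<le> exp (2 * k * lambda_max (centered x))" using that(2) k by simp
    also have "\<dots> \<le> h x" unfolding h_def using exp_lambda_max_le[OF that(1)] k by simp
    finally show ?thesis .
  qed
  then have "measure P {x \<in> space P. lambda_max (centered x) \<ge> t} \<le> (\<integral>x. h x \<partial>P) / exp (2 * k * t)"
    by (intro measure_le_of_integral[OF _ h]) (auto simp: h_def)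
  also have "\<dots> \<le> 5 / 3 * real CARD('n) / exp (2 * k * t)"
    unfolding h_def using integral_exp_pair_diff_le[OF k(2)] by (intro divide_right_mono) auto
  also have "2 * k * t = t / sqrt v" by (simp add: k_def)
  finally show ?thesis by (simp only: exp_minus divide_inverse)
qed

text \<open>For \<open>v = 0\<close> and \<open>t > 0\<close> the exponent should be read as minus
  infinity, whereas division by 0 yields 0 and would leave the bound d; hence the separate value 0,
  which the Cantelli bound provides since its numerator is \<open>v\<close>. For
  \<open>t = 0\<close> the bound is d, and d is at least 1.\<close>

theorem lambda_max_tail:
  assumes t: "0 \<le> t"
  shows "measure P {x \<in> space P. lambda_max (centered x) \<ge> t}
    \<le> (if v = 0 \<and> t > 0 then 0 else real CARD('n) * exp (- (t\<^sup>2 / (v + t * sqrt v))))"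
proof -
  interpret prob_space P by (rule prob_P)
  let ?m = "measure P {x \<in> space P. lambda_max (centered x) \<ge> t}"
  consider "t = 0" | "0 < t" "v = 0" | "0 < t" "0 < v" using t v_nonneg by linarith
  then show ?thesis
  proof cases
    case 1
    have "?m \<le> 1" by simp
    also have "1 \<le> real CARD('n)" by (simp add: Suc_le_eq)
    finally show ?thesis using 1 by simp
  next
    case 2
    then show ?thesis using cantelli_lambda_max[OF 2(1)] by simp
  next
    case 3
    define \<tau> where "\<tau> = t / sqrt v"
    have \<tau>: "0 < \<tau>" and t_eq: "t = \<tau> * sqrt v" using 3 by (simp_all add: \<tau>_def)
    define w where "w = \<tau>\<^sup>2 / (1 + \<tau>)"
    have w: "t\<^sup>2 / (v + t * sqrt v) = w"
    proof -
      have "t\<^sup>2 = v * \<tau>\<^sup>2" "v + t * sqrt v = v * (1 + \<tau>)"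
        using 3 by (simp_all add: t_eq power_mult_distrib algebra_simps)
      then show ?thesis using 3 by (simp add: w_def)
    qed
    have "?m \<le> real CARD('n) * exp (- w)"
    proof (cases "\<tau> \<le> 5 / 4")
      case True
      \<comment> \<open>Clearing the denominator \<open>1 + \<tau>\<close> in the claim
        \<open>1 \<le> (1 + 2 * \<tau>\<^sup>2) * (1 - w)\<close> leaves exactly this polynomial.
        Twice the product used below is 5/8 + 2 \<tau> - 2 \<tau>^2, which is at most the second
        factor 1 + 2 \<tau> - 2 \<tau>^2.\<close>
      have "0 \<le> \<tau>\<^sup>2 * (1 + 2 * (\<tau> * (1 - \<tau>)))"
      proof -
        have "0 \<le> (5 / 4 - \<tau>) * (\<tau> + 1 / 4)" using True \<tau> by (intro mult_nonneg_nonneg) auto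
        then show ?thesis by (intro mult_nonneg_nonneg) (auto simp: algebra_simps)
      qed
      then have "1 \<le> (1 + 2 * \<tau>\<^sup>2) * (1 - w)"
        using \<tau> by (simp add: w_def power2_eq_square field_simps)
      also have "\<dots> \<le> (1 + 2 * \<tau>\<^sup>2) * exp (- w)"
        using exp_ge_add_one_self[of "- w"] by (intro mult_left_mono) auto
      finally have "1 / (1 + 2 * \<tau>\<^sup>2) \<le> exp (- w)"
        by (simp add: divide_le_eq add_pos_nonneg mult.commute)
      moreover have "v / (v + 2 * t\<^sup>2) = 1 / (1 + 2 * \<tau>\<^sup>2)"
      proof -
        have "v + 2 * t\<^sup>2 = v * (1 + 2 * \<tau>\<^sup>2)"
          using 3 by (simp add: t_eq power_mult_distrib algebra_simps)
        then show ?thesis using 3 by simp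
      qed
      ultimately have "real CARD('n) * (v / (v + 2 * t\<^sup>2)) \<le> real CARD('n) * exp (- w)"
        by (intro mult_left_mono) auto
      then show ?thesis using cantelli_lambda_max[OF 3(1)] by linarith
    next
      case False
      \<comment> \<open>The gain \<open>\<tau> - w\<close> equals
        \<open>\<tau> / (1 + \<tau>)\<close>, which is increasing with value 5/9 at 5/4. The
        quadratic Taylor polynomial of exp at 5/9 is 277/162, already above 5/3.\<close>
      have "5 / 9 \<le> \<tau> - w" using False \<tau> by (simp add: w_def power2_eq_square field_simps)
      moreover have "5 / 3 \<le> exp (5 / 9 :: real)"
        using exp_lower_Taylor_quadratic[of "5 / 9 :: real"] by (simp add: power2_eq_square)
      ultimately have "5 / 3 \<le> exp (\<tau> - w)"
        by (meson exp_le_cancel_iff order_trans)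
      then have "5 / 3 * exp (- \<tau>) \<le> exp (- w)"
        using mult_right_mono[of "5 / 3" "exp (\<tau> - w)" "exp (- \<tau>)"] by (simp flip: exp_add)
      then have "real CARD('n) * (5 / 3 * exp (- \<tau>)) \<le> real CARD('n) * exp (- w)"
        by (intro mult_left_mono) auto
      moreover have "?m \<le> 5 / 3 * real CARD('n) * exp (- \<tau>)"
        unfolding \<tau>_def by (rule exponential_tail_lambda_max[OF 3(2)])
      ultimately show ?thesis by linarith
    qed
    then show ?thesis using 3 by (simp add: w)
  qed
qed

end

section \<open>From finiteness of \<open>v_fun\<close> to the tail bound\<close>

theorem theorem5p1:
  fixes n :: nat
    and \<mu> :: "nat \<Rightarrow> ('a::polish_space) measure"
    and f :: "(nat \<Rightarrow> 'a) \<Rightarrow> complex^'d^'d"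
    and t :: real
  assumes prob: "\<And>i. i \<in> {1..n} \<Longrightarrow> prob_space (\<mu> i)"
    and borel_sets: "\<And>i. i \<in> {1..n} \<Longrightarrow> sets (\<mu> i) = sets borel"
    and meas: "f \<in> borel_measurable (PiM {1..n} \<mu>)"
    and herm: "\<And>x. x \<in> space (PiM {1..n} \<mu>) \<Longrightarrow> hermitian (f x)"
    and finite_v: "v_fun n \<mu> f < \<infinity>"
    and t_nonneg: "0 \<le> t"
  shows "let v = enn2real (v_fun n \<mu> f) in
    measure (PiM {1..n} \<mu>)
      {x \<in> space (PiM {1..n} \<mu>). lambda_max (f x - mat_integral (PiM {1..n} \<mu>) f) \<ge> t}
    \<le> (if v = 0 \<and> t > 0 then 0 else real CARD('d) * exp (- (t\<^sup>2 / (v + t * sqrt v))))"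
proof -
  let ?I = "{1..n}"
  define v where "v = enn2real (v_fun n \<mu> f)"
  have v: "ennreal v = v_fun n \<mu> f" and v0: "0 \<le> v" using finite_v by (simp_all add: v_def)
  \<comment> \<open>The locale requires a probability measure at every index. Indices outside
    \<open>{1..n}\<close> receive a point mass, which leaves the product measure unchanged.\<close>
  define \<nu> where "\<nu> i = (if i \<in> ?I then \<mu> i else return borel undefined)" for i
  have \<nu>: "\<nu> i = \<mu> i" if "i \<in> ?I" for i using that by (simp add: \<nu>_def)
  have PiM_\<nu>: "PiM ?I \<nu> = PiM ?I \<mu>" by (rule PiM_cong) (simp_all add: \<nu>)
  have upd: "x(i := z) \<in> space (PiM ?I \<mu>)" if "x \<in> space (PiM ?I \<mu>)" "i \<in> ?I" "z \<in> space (\<mu> i)" for x i z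
    using that by (auto simp: space_PiM PiE_iff extensional_def)
  let ?D = "\<lambda>x i z. f x - f (x(i := z))"
  have D: "hermitian (?D x i z)" if "x \<in> space (PiM ?I \<mu>)" "i \<in> ?I" "z \<in> space (\<mu> i)" for x i z
    by (intro hermitian_diff herm upd that)
  have int: "\<forall>i\<in>?I. mat_integrable (\<mu> i) (\<lambda>z. mat_square (?D x i z))"
    and le: "op_norm (\<Sum>i=1..n. mat_integral (\<mu> i) (\<lambda>z. mat_square (?D x i z))) \<le> v"
    if x: "x \<in> space (PiM ?I \<mu>)" for x
  proof -
    have ub: "(if \<forall>i\<in>?I. mat_integrable (\<mu> i) (\<lambda>z. mat_square (?D x i z))
      then ennreal (op_norm (\<Sum>i=1..n. mat_integral (\<mu> i) (\<lambda>z. mat_square (?D x i z))))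
      else \<infinity>) \<le> ennreal v"
      unfolding v v_fun_def by (rule SUP_upper[OF x])
    \<comment> \<open>A non-integrable square at any single \<open>x\<close> would put the value
      infinity into the supremum, so finiteness forces integrability at every point.\<close>
    show int: "\<forall>i\<in>?I. mat_integrable (\<mu> i) (\<lambda>z. mat_square (?D x i z))"
    proof (rule ccontr)
      assume not_int: "\<not> ?thesis"
      show False using ub unfolding if_not_P[OF not_int] by (simp add: top_unique)
    qed
    show "op_norm (\<Sum>i=1..n. mat_integral (\<mu> i) (\<lambda>z. mat_square (?D x i z))) \<le> v"
      using ub unfolding if_P[OF int] by (simp add: ennreal_le_iff[OF v0])
  qed
  interpret coordinate_fluctuation ?I \<nu> f v
  proof (rule coordinate_fluctuation.intro)
    show "prob_space (\<nu> i)" for i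
      by (cases "i \<in> ?I") (auto simp: \<nu>_def prob intro: prob_space_return)
    show "finite ?I" "0 \<le> v" by (simp_all add: v0)
    show "f \<in> borel_measurable (PiM ?I \<nu>)" unfolding PiM_\<nu> by (rule meas)
    fix x assume "x \<in> space (PiM ?I \<nu>)"
    then have x: "x \<in> space (PiM ?I \<mu>)" unfolding PiM_\<nu> .
    show "hermitian (f x)" by (rule herm[OF x])
    note bound = sum_integral_norm_mult_sq_le[where I = ?I and \<mu> = \<mu> and D = "?D x" and v = v,
        OF _ D[OF x] int[OF x, rule_format] le[OF x]]
    \<comment> \<open>The test matrix \<open>mat 1\<close> turns integrability of the tested
      products into that of the squared increments.\<close>
    show "integrable (\<nu> i) (\<lambda>z. (norm (?D x i z))\<^sup>2)" if "i \<in> ?I" for i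
      using bound(1)[of i "mat 1"] that by (simp add: \<nu> del: fun_upd_apply)
    show "(\<Sum>i\<in>?I. \<integral>z. (norm (?D x i z ** C))\<^sup>2 \<partial>\<nu> i) \<le> v * (norm C)\<^sup>2" for C :: "complex^'d^'d"
      using bound(2)[of C] by (simp add: \<nu> del: fun_upd_apply)
  qed
  show ?thesis
    using lambda_max_tail[OF t_nonneg] unfolding PiM_\<nu> centered_def Let_def v_def .
qed

end
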